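(* Let $n\ge 1$, $t_0\in\mathbb{R}$, $f\in C^\infty(\mathbb{R}^{n+1})$, and let $M$ be a number with $M^2\in\mathbb{R}\setminus\{0\}$; put $m=|M|$. For each $b\in\mathbb{R}$ let $w(x,t;b)$ be the solution of the Cauchy problem $$w_{tt}-\Delta w=0 \ \text{ in } \mathbb{R}^{n+1},\qquad w(x,0;b)=f(x,b),\quad w_t(x,0;b)=0\ \text{ in }\mathbb{R}^n .$$ Define $$u_{\mathcal Re}(x,t)=\int_{t_0}^{t}db\int_0^{t-b}J_0\!\left(m\sqrt{(t-b)^2-r^2}\right)w(x,r;b)\,dr,\qquad x\in\mathbb{R}^n,$$ $$u_{\mathcal Im}(x,t)=\int_{t_0}^{t}db\int_0^{t-b}I_0\!\left(m\sqrt{(t-b)^2-r^2}\right)w(x,r;b)\,dr,\qquad x\in\mathbb{R}^n .$$ Then $u=u_{\mathcal Re}$ if $M^2>0$, and $u=u_{\mathcal Im}$ if $M^2<0$, is a solution of the problem $$u_{tt}-\Delta u+M^2u=f(x,t)\ \text{ in }\mathbb{R}^{n+1},\qquad u(x,t_0)=0,\quad u_t(x,t_0)=0\ \text{ in }\mathbb{R}^n .$$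
   Context: $\Delta$ is the Laplacian in $x\in\mathbb{R}^n$. $J_0$ is the Bessel function of the first kind of order $0$, and $I_0$ is the modified Bessel function of the first kind of order $0$. $M$ is real when $M^2>0$ and purely imaginary when $M^2<0$. Integrals with upper limit smaller than the lower limit are oriented integrals. *)

theory Defs
  imports "HOL-Analysis.Analysis"
begin

primrec C_class :: "nat \<Rightarrow> ('a::euclidean_space \<Rightarrow> 'b::real_normed_vector) \<Rightarrow> bool" where
  "C_class 0 g \<longleftrightarrow> continuous_on UNIV g"
| "C_class (Suc k) g \<longleftrightarrow>
     (\<forall>p. g differentiable (at p)) \<and> (\<forall>v. C_class k (\<lambda>p. frechet_derivative g (at p) v))"

definition C_infinity :: "('a::euclidean_space \<Rightarrow> 'b::real_normed_vector) \<Rightarrow> bool" where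
  "C_infinity g \<longleftrightarrow> (\<forall>k. C_class k g)"

text \<open>
  A point of space-time \<open>\<real>\<^sup>n \<times> \<real>\<close> is a pair \<open>(x, t)\<close>. The derivatives below are
  ordinary one-variable derivatives along coordinate directions.
\<close>

definition dt :: "('a \<times> real \<Rightarrow> complex) \<Rightarrow> 'a \<times> real \<Rightarrow> complex" where
  "dt u = (\<lambda>(x, t). vector_derivative (\<lambda>s. u (x, s)) (at t))"

definition dx :: "'n::finite \<Rightarrow> ((real ^ 'n) \<times> real \<Rightarrow> complex) \<Rightarrow> (real ^ 'n) \<times> real \<Rightarrow> complex" where
  "dx i u = (\<lambda>(x, t). vector_derivative (\<lambda>s. u (x + s *\<^sub>R axis i 1, t)) (at 0))"

definition laplacian :: "((real ^ 'n::finite) \<times> real \<Rightarrow> complex) \<Rightarrow> (real ^ 'n) \<times> real \<Rightarrow> complex" where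
  "laplacian u p = (\<Sum>i\<in>UNIV. dx i (dx i u) p)"

definition bessel_J0 :: "real \<Rightarrow> real" where
  "bessel_J0 z = (\<Sum>k. (-1) ^ k / (fact k)\<^sup>2 * (z / 2) ^ (2 * k))"

definition bessel_I0 :: "real \<Rightarrow> real" where
  "bessel_I0 z = (\<Sum>k. 1 / (fact k)\<^sup>2 * (z / 2) ^ (2 * k))"

text \<open>
  A classical (twice continuously differentiable) solution on all of space-time of
  \<open>u\<^sub>t\<^sub>t - \<Delta>u + c u = g\<close> with data \<open>u = \<phi>\<close>, \<open>u\<^sub>t = \<psi>\<close> at time \<open>t0\<close>;
  the wave equation is the case \<open>c = 0\<close>.
\<close>

definition cauchy_solution ::
  "complex \<Rightarrow> ((real ^ 'n::finite) \<times> real \<Rightarrow> complex) \<Rightarrow> real \<Rightarrow> (real ^ 'n \<Rightarrow> complex) \<Rightarrow> (real ^ 'n \<Rightarrow> complex)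
    \<Rightarrow> ((real ^ 'n) \<times> real \<Rightarrow> complex) \<Rightarrow> bool" where
  "cauchy_solution c g t0 \<phi> \<psi> u \<longleftrightarrow>
     C_class 2 u \<and>
     (\<forall>p. dt (dt u) p - laplacian u p + c * u p = g p) \<and>
     (\<forall>x. u (x, t0) = \<phi> x) \<and> (\<forall>x. dt u (x, t0) = \<psi> x)"

text \<open>
  The interval integral \<open>LBINT s=a..b\<close> is oriented: for \<open>b < a\<close> it is minus the integral over
  \<open>(b, a)\<close>.
\<close>

definition u_Re :: "real \<Rightarrow> real \<Rightarrow> (real \<Rightarrow> (real ^ 'n::finite) \<times> real \<Rightarrow> complex) \<Rightarrow> (real ^ 'n) \<times> real \<Rightarrow> complex" where
  "u_Re m t0 w = (\<lambda>(x, t).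
     LBINT b=t0..t. (LBINT r=0..ereal (t - b). bessel_J0 (m * sqrt ((t - b)\<^sup>2 - r\<^sup>2)) *\<^sub>R w b (x, r)))"

definition u_Im :: "real \<Rightarrow> real \<Rightarrow> (real \<Rightarrow> (real ^ 'n::finite) \<times> real \<Rightarrow> complex) \<Rightarrow> (real ^ 'n) \<times> real \<Rightarrow> complex" where
  "u_Im m t0 w = (\<lambda>(x, t).
     LBINT b=t0..t. (LBINT r=0..ereal (t - b). bessel_I0 (m * sqrt ((t - b)\<^sup>2 - r\<^sup>2)) *\<^sub>R w b (x, r)))"

end

theory Submission
  imports Defs
begin

text \<open>
  Nothing is assumed about how \<open>w(x,r;b)\<close> depends on \<open>b\<close>, so the main point is that the family is
  jointly smooth. For weights \<open>(1 - |z|\<^sup>2)\<^sup>a\<close> on the unit ball the averages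
  \<open>Q(x,T) = \<integral> (1 - |z|\<^sup>2)\<^sup>a f(x + T z, b) dz\<close> are smooth in all variables and solve
  \<open>Q\<^sub>T\<^sub>T + (\<kappa>/T) Q\<^sub>T = \<Delta>Q\<close> with \<open>\<kappa> = n + 1 + 2a\<close>. The operator \<open>(\<kappa> - 1) Q + T Q\<^sub>T\<close> lowers
  \<open>\<kappa>\<close> by \<open>2\<close>; choosing \<open>a\<close> with \<open>\<kappa>\<close> an even integer and descending to \<open>\<kappa> = 0\<close> gives, in every
  dimension, a smooth solution of the wave equation that is also smooth in \<open>b\<close>. By the energy
  inequality on backward light cones it coincides with \<open>w(\<cdot>;b)\<close>. Everything in sight is then smooth:
  the inner integral \<open>v(x,\<tau>;b)\<close> solves the Klein--Gordon equation with data \<open>0\<close> and \<open>f(x,b)\<close>, by an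
  integration by parts and the Bessel equation, and \<open>u(x,t) = \<integral> v(x,t-b;b) db\<close> is Duhamel's formula.
\<close>

section \<open>Directional derivatives and functions of class \<open>C\<^sup>k\<close>\<close>

text \<open>Each \<open>w b\<close> is only known to be of class C^2 for its own b, with no bound at
  spatial infinity. Uniqueness is therefore localised by a weight that vanishes on the boundary of a
  light cone: all integrals then run over one fixed box, and integrations by parts leave no boundary
  terms. The same truncated power is the weight of the ball averages. The parameter b is carried as
  an extra coordinate: averages and Laplacians act only along an embedding \<open>\<iota>\<close>,
  eventually x to (x, 0), so smoothness in b needs no argument of its own. The descent uses
  operators with coefficients polynomial in T, since a division by T would lose the initial plane T
  = 0, where the data live. Both Bessel functions enter through a power series in y = tau^2 - r^2.
  The square root in the statement is thus harmless, and the kernel is smooth up to and across r =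
  tau, as differentiation through the variable upper limit requires. Oriented integrals are rescaled
  to [0, 1], so in the integral formulas times before \<open>t0\<close> need no separate
  treatment.\<close>

definition D :: "'a::euclidean_space \<Rightarrow> ('a \<Rightarrow> 'b::real_normed_vector) \<Rightarrow> 'a \<Rightarrow> 'b" where
  "D v g = (\<lambda>p. frechet_derivative g (at p) v)"

lemma D_eqI: "(g has_derivative g') (at p) \<Longrightarrow> D v g p = g' v"
  unfolding D_def by (metis frechet_derivative_at)

lemma has_derivative_D: "g differentiable (at p) \<Longrightarrow> (g has_derivative (\<lambda>v. D v g p)) (at p)"
  unfolding D_def by (simp add: frechet_derivative_works[symmetric])

lemma C_class_Suc: "C_class (Suc k) g \<longleftrightarrow> (\<forall>p. g differentiable (at p)) \<and> (\<forall>v. C_class k (D v g))"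
  by (simp add: D_def)

text \<open>Derivatives are unique, so any family of candidates may stand for
  \<open>frechet_derivative\<close>. All closure properties below are inductions on k through this
  rule.\<close>

lemma C_class_SucI:
  assumes "\<And>p. (g has_derivative g' p) (at p)" "\<And>v. C_class k (\<lambda>p. g' p v)"
  shows "C_class (Suc k) g"
proof -
  have "D v g = (\<lambda>p. g' p v)" for v
    using D_eqI[OF assms(1)] by fast
  then show ?thesis
    using assms by (auto simp: C_class_Suc differentiable_def simp del: C_class.simps)
qed

lemma C_class_Suc_imp: "C_class (Suc k) g \<Longrightarrow> C_class k g"
proof (induction k arbitrary: g)
  case 0
  then show ?case
    by (auto simp: continuous_on_eq_continuous_at differentiable_imp_continuous_within)
next
  case (Suc k)
  then show ?case
    unfolding C_class_Suc[of "Suc k"] C_class_Suc[of k g] by (meson C_class_Suc)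
qed

lemma C_class_mono: "j \<le> k \<Longrightarrow> C_class k g \<Longrightarrow> C_class j g"
proof (induction k)
  case (Suc k)
  then show ?case
    using C_class_Suc_imp le_Suc_eq by blast
qed simp

lemma C_class_D: "C_class (Suc k) g \<Longrightarrow> C_class k (D v g)"
  by (simp only: C_class_Suc)

lemma C_class_differentiable: "C_class (Suc k) g \<Longrightarrow> g differentiable (at p)"
  by (simp only: C_class_Suc)

lemma C_class_has_derivative: "C_class (Suc k) g \<Longrightarrow> (g has_derivative (\<lambda>v. D v g p)) (at p)"
  by (rule has_derivative_D) (rule C_class_differentiable)

lemma C_class_continuous: "C_class k g \<Longrightarrow> continuous_on UNIV g"
  using C_class_mono[of 0 k g] by simp

section \<open>Closure of the classes C^k under algebra and composition\<close>

lemma C_class_const: "C_class k (\<lambda>_. c)"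
proof (induction k arbitrary: c)
  case (Suc k)
  show ?case
    by (rule C_class_SucI[where g' = "\<lambda>_ _. 0"]) (auto intro: Suc)
qed simp

lemma C_class_add:
  assumes "C_class k g" "C_class k h"
  shows "C_class k (\<lambda>p. g p + h p)"
  using assms
proof (induction k arbitrary: g h)
  case (Suc k)
  show ?case
  proof (rule C_class_SucI)
    show "((\<lambda>p. g p + h p) has_derivative (\<lambda>v. D v g p + D v h p)) (at p)" for p
      by (intro has_derivative_add C_class_has_derivative[OF Suc.prems(1)] C_class_has_derivative[OF Suc.prems(2)])
    show "C_class k (\<lambda>p. D v g p + D v h p)" for v
      by (intro Suc.IH C_class_D Suc.prems)
  qed
qed (auto intro: continuous_intros)

lemma C_class_sum:
  assumes "\<And>i. i \<in> I \<Longrightarrow> C_class k (g i)"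
  shows "C_class k (\<lambda>p. \<Sum>i\<in>I. g i p)"
  using assms
  by (induction I rule: infinite_finite_induct) (auto intro: C_class_const C_class_add)

lemma C_class_scaleR:
  fixes a :: "'a::euclidean_space \<Rightarrow> real"
  assumes "C_class k a" "C_class k g"
  shows "C_class k (\<lambda>p. a p *\<^sub>R g p)"
  using assms
proof (induction k arbitrary: a g)
  case (Suc k)
  show ?case
  proof (rule C_class_SucI)
    show "((\<lambda>p. a p *\<^sub>R g p) has_derivative (\<lambda>v. a p *\<^sub>R D v g p + D v a p *\<^sub>R g p)) (at p)" for p
      by (intro has_derivative_scaleR C_class_has_derivative[OF Suc.prems(1)] C_class_has_derivative[OF Suc.prems(2)])
    show "C_class k (\<lambda>p. a p *\<^sub>R D v g p + D v a p *\<^sub>R g p)" for v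
      by (intro C_class_add Suc.IH C_class_D Suc.prems C_class_Suc_imp[OF Suc.prems(1)] C_class_Suc_imp[OF Suc.prems(2)])
  qed
qed (auto intro: continuous_intros)

lemma C_class_bounded_linear:
  assumes "bounded_linear L"
  shows "C_class k L"
proof (cases k)
  case 0
  then show ?thesis using assms by (simp add: linear_continuous_on)
next
  case (Suc j)
  show ?thesis unfolding Suc
    by (rule C_class_SucI[where g' = "\<lambda>_. L"])
      (auto intro: C_class_const bounded_linear_imp_has_derivative[OF assms])
qed

lemma C_class_bounded_linear_compose:
  assumes "bounded_linear L" "C_class k g"
  shows "C_class k (\<lambda>p. L (g p))"
  using assms(2)
proof (induction k arbitrary: g)
  case 0
  then show ?case using assms(1) by (simp add: linear_continuous_on bounded_linear.continuous_on)
next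
  case (Suc k)
  show ?case
  proof (rule C_class_SucI)
    show "((\<lambda>p. L (g p)) has_derivative (\<lambda>v. L (D v g p))) (at p)" for p
      by (intro bounded_linear.has_derivative[OF assms(1)] C_class_has_derivative[OF Suc.prems])
    show "C_class k (\<lambda>p. L (D v g p))" for v
      by (intro Suc.IH C_class_D Suc.prems)
  qed
qed

lemma D_eq_sum_Basis:
  assumes "g differentiable (at p)"
  shows "D v g p = (\<Sum>e\<in>Basis. (v \<bullet> e) *\<^sub>R D e g p)"
proof -
  have "linear (\<lambda>v. D v g p)"
    using has_derivative_D[OF assms] has_derivative_linear by blast
  from linear_sum[OF this, of "\<lambda>e. (v \<bullet> e) *\<^sub>R e" Basis] linear_cmul[OF this]
  have "D (\<Sum>e\<in>Basis. (v \<bullet> e) *\<^sub>R e) g p = (\<Sum>e\<in>Basis. (v \<bullet> e) *\<^sub>R D e g p)"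
    by simp
  then show ?thesis
    by (simp add: euclidean_representation)
qed

lemma D_scaleR: "g differentiable (at p) \<Longrightarrow> D (c *\<^sub>R v) g p = c *\<^sub>R D v g p"
  using has_derivative_D[of g p] has_derivative_linear linear_cmul by blast

lemma D_add_dir: "g differentiable (at p) \<Longrightarrow> D (v + v') g p = D v g p + D v' g p"
  using has_derivative_D[of g p] has_derivative_linear linear_add by blast

lemma D_compose:
  assumes "g differentiable (at (h p))" "(h has_derivative h') (at p)"
  shows "D v (\<lambda>p. g (h p)) p = D (h' v) g (h p)"
  by (rule D_eqI) (rule has_derivative_compose[OF assms(2) has_derivative_D[OF assms(1)]])

lemma D_compose_affine:
  assumes "C_class (Suc k) g" "\<And>p. (h has_derivative L) (at p)"
  shows "D v (\<lambda>p. g (h p)) = (\<lambda>p. D (L v) g (h p))"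
  by (rule ext, rule D_compose[OF C_class_differentiable[OF assms(1)] assms(2)])

text \<open>By the chain rule the direction \<open>D v h p\<close> in which g is differentiated
  varies with p, while the induction hypothesis concerns fixed directions. Expanding it in the basis
  separates the two: scalar coefficients of class C^k times fixed derivatives of g along h.\<close>

lemma C_class_compose:
  fixes g :: "'b::euclidean_space \<Rightarrow> 'c::real_normed_vector" and h :: "'a::euclidean_space \<Rightarrow> 'b"
  assumes "C_class k g" "C_class k h"
  shows "C_class k (\<lambda>p. g (h p))"
  using assms
proof (induction k arbitrary: g)
  case 0
  then show ?case
    by (auto intro: continuous_on_compose2)
next
  case (Suc k)
  show ?case
  proof (rule C_class_SucI)
    show "((\<lambda>p. g (h p)) has_derivative (\<lambda>v. \<Sum>e\<in>Basis. (D v h p \<bullet> e) *\<^sub>R D e g (h p))) (at p)" for p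
      by (subst D_eq_sum_Basis[symmetric], rule C_class_differentiable[OF Suc.prems(1)],
          rule has_derivative_compose[OF C_class_has_derivative[OF Suc.prems(2)] C_class_has_derivative[OF Suc.prems(1)]])
    show "C_class k (\<lambda>p. \<Sum>e\<in>Basis. (D v h p \<bullet> e) *\<^sub>R D e g (h p))" for v
      by (intro C_class_sum C_class_scaleR C_class_bounded_linear_compose[OF bounded_linear_inner_left]
          Suc.IH C_class_D Suc.prems C_class_Suc_imp[OF Suc.prems(2)])
  qed
qed

lemma C_class_Pair:
  assumes "C_class k g" "C_class k h"
  shows "C_class k (\<lambda>p. (g p, h p))"
  using assms
proof (induction k arbitrary: g h)
  case (Suc k)
  show ?case
  proof (rule C_class_SucI)
    show "((\<lambda>p. (g p, h p)) has_derivative (\<lambda>v. (D v g p, D v h p))) (at p)" for p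
      by (intro has_derivative_Pair C_class_has_derivative[OF Suc.prems(1)] C_class_has_derivative[OF Suc.prems(2)])
    show "C_class k (\<lambda>p. (D v g p, D v h p))" for v
      by (intro Suc.IH C_class_D Suc.prems)
  qed
qed (auto intro: continuous_intros)

section \<open>Differentiation under the integral sign\<close>

text \<open>The weight \<open>\<rho>\<close> is kept apart from \<open>G\<close> because it is only
  continuous: it will be a real power of 1 - |z|^2 cut off at the unit sphere. No derivative ever
  falls on it here, so the integral is as smooth in p as \<open>G\<close>.\<close>

lemma param_integral_has_derivative:
  fixes G :: "'a::euclidean_space \<times> 'z::euclidean_space \<Rightarrow> 'c::banach"
  assumes G: "C_class (Suc k) G" and rho: "continuous_on (cbox a b) \<rho>"
  shows "((\<lambda>p. integral (cbox a b) (\<lambda>z. \<rho> z *\<^sub>R G (p, z))) has_derivative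
    (\<lambda>v. integral (cbox a b) (\<lambda>z. \<rho> z *\<^sub>R D (v, 0) G (p, z)))) (at p)"
proof -
  \<comment> \<open>\<open>leibniz_rule\<close> wants the derivative as a bounded linear map that is
    continuous in both variables; that continuity is checked direction by direction.\<close>
  define fx where "fx = (\<lambda>p z. Blinfun (\<lambda>v. \<rho> z *\<^sub>R D (v, 0) G (p, z)))"
  have der: "((\<lambda>p. \<rho> z *\<^sub>R G (p, z)) has_derivative (\<lambda>v. \<rho> z *\<^sub>R D (v, 0) G (p, z))) (at p)" for p z
    by (intro has_derivative_scaleR_right has_derivative_compose[OF _ C_class_has_derivative[OF G]])
      (auto intro!: derivative_eq_intros)
  have fx: "blinfun_apply (fx p z) = (\<lambda>v. \<rho> z *\<^sub>R D (v, 0) G (p, z))" for p z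
    unfolding fx_def
    by (rule bounded_linear_Blinfun_apply) (rule has_derivative_bounded_linear[OF der])
  have contD: "continuous_on UNIV (D v G)" for v
    using C_class_continuous C_class_D[OF G] by blast
  have contG: "continuous_on UNIV G"
    by (rule C_class_continuous[OF G])
  have c2: "continuous_on (UNIV \<times> cbox a b) (\<lambda>x. \<rho> (snd x) *\<^sub>R D (v, 0) G x)" for v
    by (intro continuous_intros continuous_on_compose2[OF rho] continuous_on_subset[OF contD]) auto
  have cont: "continuous_on (UNIV \<times> cbox a b) (\<lambda>(p, z). fx p z)"
    by (rule continuous_on_blinfun_componentwise) (use c2 in \<open>simp add: split_beta fx\<close>)
  have int: "(\<lambda>z. \<rho> z *\<^sub>R G (p, z)) integrable_on cbox a b" for p
    by (intro integrable_continuous continuous_intros rho continuous_on_compose2[OF contG]) auto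
  have main: "((\<lambda>p. integral (cbox a b) (\<lambda>z. \<rho> z *\<^sub>R G (p, z))) has_derivative
      integral (cbox a b) (fx p)) (at p)"
    by (rule leibniz_rule[where fx = fx and U = UNIV]) (use der fx int cont in auto)
  have "fx p integrable_on cbox a b"
    using continuous_on_compose2[OF cont, of "cbox a b" "\<lambda>z. (p, z)"]
    by (intro integrable_continuous) (simp add: image_subset_iff continuous_on_Pair)
  then have "blinfun_apply (integral (cbox a b) (fx p)) v = integral (cbox a b) (\<lambda>z. \<rho> z *\<^sub>R D (v, 0) G (p, z))" for v
    by (simp add: blinfun_apply_integral fx)
  then have "blinfun_apply (integral (cbox a b) (fx p)) = (\<lambda>v. integral (cbox a b) (\<lambda>z. \<rho> z *\<^sub>R D (v, 0) G (p, z)))"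
    by (rule ext)
  with main show ?thesis
    by simp
qed

lemma C_class_param_integral:
  fixes G :: "'a::euclidean_space \<times> 'z::euclidean_space \<Rightarrow> 'c::banach"
  assumes "C_class k G" and rho: "continuous_on (cbox a b) \<rho>"
  shows "C_class k (\<lambda>p. integral (cbox a b) (\<lambda>z. \<rho> z *\<^sub>R G (p, z)))"
  using assms(1)
proof (induction k arbitrary: G)
  case 0
  then have "continuous_on UNIV G" by simp
  then have "continuous_on (UNIV \<times> cbox a b) (\<lambda>x. \<rho> (snd x) *\<^sub>R G x)"
    by (intro continuous_intros continuous_on_compose2[OF rho] continuous_on_subset[OF \<open>continuous_on UNIV G\<close>]) auto
  then have "continuous_on UNIV (\<lambda>p. integral (cbox a b) (\<lambda>z. \<rho> z *\<^sub>R G (p, z)))"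
    by (intro integral_continuous_on_param) (simp add: split_beta)
  then show ?case by simp
next
  case (Suc k)
  show ?case
    by (rule C_class_SucI[OF param_integral_has_derivative[OF Suc.prems rho]])
      (intro Suc.IH C_class_D Suc.prems)
qed

lemma D_param_integral:
  fixes G :: "'a::euclidean_space \<times> 'z::euclidean_space \<Rightarrow> 'c::banach"
  assumes "C_class (Suc k) G" "continuous_on (cbox a b) \<rho>"
  shows "D v (\<lambda>p. integral (cbox a b) (\<lambda>z. \<rho> z *\<^sub>R G (p, z))) p =
    integral (cbox a b) (\<lambda>z. \<rho> z *\<^sub>R D (v, 0) G (p, z))"
  by (rule D_eqI[OF param_integral_has_derivative[OF assms]])

lemma has_vector_derivative_chain:
  assumes "(h has_vector_derivative v) (at t)" "(g has_derivative g') (at (h t))"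
  shows "((\<lambda>s. g (h s)) has_vector_derivative g' v) (at t)"
  using vector_derivative_diff_chain_within[of h v t UNIV g g'] assms
  by (simp add: o_def has_derivative_at_withinI)

lemma C_class_has_vector_derivative:
  assumes "C_class (Suc k) g" "(h has_vector_derivative h') (at t)"
  shows "((\<lambda>s. g (h s)) has_vector_derivative D h' g (h t)) (at t)"
  by (rule has_vector_derivative_chain[OF assms(2) C_class_has_derivative[OF assms(1)]])

text \<open>
  Differentiating \<open>g(p + s v + r w) = g(p + s v) + \<integral>\<^sub>0\<^sup>r D\<^sub>w g(p + s v + \<rho> w) d\<rho>\<close> first in \<open>s\<close> and
  then in \<open>r\<close> yields the symmetry of second derivatives.
\<close>
lemma D_commute:
  fixes g :: "'a::euclidean_space \<Rightarrow> 'c::banach"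
  assumes "C_class 2 g"
  shows "D v (D w g) p = D w (D v g) p"
proof -
  have g2: "C_class (Suc (Suc 0)) g" using assms by (simp add: numeral_2_eq_2)
  have g1: "C_class (Suc 0) g" using g2 by (rule C_class_Suc_imp)
  have Dg1: "C_class (Suc 0) (D u g)" for u using g2 by (rule C_class_D)
  define h where "h = (\<lambda>s r. p + s *\<^sub>R v + r *\<^sub>R w)"
  have hs: "((\<lambda>s. h s r) has_vector_derivative v) (at s within X)" for s r X
    unfolding h_def by (auto intro!: derivative_eq_intros)
  have hr: "((\<lambda>r. h s r) has_vector_derivative w) (at r within X)" for s r X
    unfolding h_def by (auto intro!: derivative_eq_intros)
  have eq: "g (h s r) = g (h s 0) + integral {0..r} (\<lambda>\<rho>. D w g (h s \<rho>))" if "r \<ge> 0" for s r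
  proof -
    have "((\<lambda>\<rho>. D w g (h s \<rho>)) has_integral g (h s r) - g (h s 0)) {0..r}"
      by (rule fundamental_theorem_of_calculus[OF that])
        (rule has_vector_derivative_at_within[OF C_class_has_vector_derivative[OF g1 hr]])
    then show ?thesis by (simp add: integral_unique)
  qed
  have cDD: "continuous_on X (\<lambda>x. D u (D u' g) (h (k1 x) (k2 x)))" if "continuous_on X k1" "continuous_on X k2"
    for u u' X and k1 k2 :: "'x::topological_space \<Rightarrow> real"
    unfolding h_def
    by (intro continuous_on_compose2[OF C_class_continuous[OF C_class_D[OF Dg1]]] continuous_intros that) auto
  have cD: "continuous_on X (\<lambda>x. D u g (h (k1 x) (k2 x)))" if "continuous_on X k1" "continuous_on X k2"
    for u X and k1 k2 :: "'x::topological_space \<Rightarrow> real"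
    unfolding h_def
    by (intro continuous_on_compose2[OF C_class_continuous[OF Dg1]] continuous_intros that) auto
  have eq2: "D v g (h 0 r) = D v g (h 0 0) + integral {0..r} (\<lambda>\<rho>. D v (D w g) (h 0 \<rho>))" if "r \<ge> 0" for r
  proof -
    have "((\<lambda>s. integral (cbox 0 r) (\<lambda>\<rho>. D w g (h s \<rho>))) has_vector_derivative
        integral (cbox 0 r) (\<lambda>\<rho>. D v (D w g) (h 0 \<rho>))) (at 0 within UNIV)"
    proof (rule leibniz_rule_vector_derivative)
      show "((\<lambda>s. D w g (h s \<rho>)) has_vector_derivative D v (D w g) (h s \<rho>)) (at s within UNIV)" for s \<rho>
        by (rule C_class_has_vector_derivative[OF Dg1 hs])
      show "(\<lambda>\<rho>. D w g (h s \<rho>)) integrable_on cbox 0 r" for s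
        by (intro integrable_continuous cD continuous_intros)
      show "continuous_on (UNIV \<times> cbox 0 r) (\<lambda>(s, \<rho>). D v (D w g) (h s \<rho>))"
        unfolding split_beta by (intro cDD continuous_intros)
    qed auto
    then have "((\<lambda>s. g (h s 0) + integral {0..r} (\<lambda>\<rho>. D w g (h s \<rho>))) has_vector_derivative
        D v g (h 0 0) + integral {0..r} (\<lambda>\<rho>. D v (D w g) (h 0 \<rho>))) (at 0)"
      by (intro has_vector_derivative_add C_class_has_vector_derivative[OF g1 hs]) (simp add: cbox_interval)
    then have "((\<lambda>s. g (h s r)) has_vector_derivative
        D v g (h 0 0) + integral {0..r} (\<lambda>\<rho>. D v (D w g) (h 0 \<rho>))) (at 0)"
      by (simp add: eq[OF that])
    then show ?thesis
      using C_class_has_vector_derivative[OF g1 hs] vector_derivative_unique_at by blast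
  qed
  have "((\<lambda>r. integral {0..r} (\<lambda>\<rho>. D v (D w g) (h 0 \<rho>))) has_vector_derivative D v (D w g) (h 0 0)) (at 0 within {0..1})"
    by (rule integral_has_vector_derivative) (auto intro!: cDD continuous_intros)
  then have "((\<lambda>r. D v g (h 0 0) + integral {0..r} (\<lambda>\<rho>. D v (D w g) (h 0 \<rho>))) has_vector_derivative D v (D w g) (h 0 0)) (at 0 within {0..1})"
    by (auto intro!: derivative_eq_intros)
  then have "((\<lambda>r. D v g (h 0 r)) has_vector_derivative D v (D w g) (h 0 0)) (at 0 within {0..1})"
    by (rule has_vector_derivative_transform[rotated 2]) (auto intro!: eq2)
  moreover have "((\<lambda>r. D v g (h 0 r)) has_vector_derivative D w (D v g) (h 0 0)) (at 0 within {0..1})"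
    by (rule has_vector_derivative_at_within[OF C_class_has_vector_derivative[OF Dg1 hr]])
  ultimately have "D v (D w g) (h 0 0) = D w (D v g) (h 0 0)"
    by (rule vector_derivative_unique_within[rotated])
      (auto simp: trivial_limit_within islimpt_Icc)
  then show ?thesis
    by (simp add: h_def)
qed

section \<open>Calculus of smooth functions\<close>

lemma C_infinity_D: "C_infinity g \<Longrightarrow> C_infinity (D v g)"
  unfolding C_infinity_def using C_class_D by blast

lemma C_infinity_const: "C_infinity (\<lambda>_. c)"
  by (simp add: C_infinity_def C_class_const)

lemma C_infinity_add: "C_infinity g \<Longrightarrow> C_infinity h \<Longrightarrow> C_infinity (\<lambda>p. g p + h p)"
  by (simp add: C_infinity_def C_class_add)

lemma C_infinity_sum: "(\<And>i. i \<in> I \<Longrightarrow> C_infinity (g i)) \<Longrightarrow> C_infinity (\<lambda>p. \<Sum>i\<in>I. g i p)"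
  by (simp add: C_infinity_def C_class_sum)

lemma C_infinity_scaleR:
  fixes a :: "'a::euclidean_space \<Rightarrow> real"
  shows "C_infinity a \<Longrightarrow> C_infinity g \<Longrightarrow> C_infinity (\<lambda>p. a p *\<^sub>R g p)"
  by (simp add: C_infinity_def C_class_scaleR)

lemma C_infinity_Pair: "C_infinity g \<Longrightarrow> C_infinity h \<Longrightarrow> C_infinity (\<lambda>p. (g p, h p))"
  by (simp add: C_infinity_def C_class_Pair)

lemma C_infinity_compose:
  fixes g :: "'b::euclidean_space \<Rightarrow> 'c::real_normed_vector" and h :: "'a::euclidean_space \<Rightarrow> 'b"
  shows "C_infinity g \<Longrightarrow> C_infinity h \<Longrightarrow> C_infinity (\<lambda>p. g (h p))"
  by (simp add: C_infinity_def C_class_compose)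

lemma C_infinity_bounded_linear: "bounded_linear L \<Longrightarrow> C_infinity L"
  by (simp add: C_infinity_def C_class_bounded_linear)

lemma C_infinity_fst:
  fixes h :: "'a::euclidean_space \<Rightarrow> 'b::euclidean_space \<times> 'c::euclidean_space"
  shows "C_infinity h \<Longrightarrow> C_infinity (\<lambda>p. fst (h p))"
  by (rule C_infinity_compose[OF C_infinity_bounded_linear[OF bounded_linear_fst]])

lemma C_infinity_snd:
  fixes h :: "'a::euclidean_space \<Rightarrow> 'b::euclidean_space \<times> 'c::euclidean_space"
  shows "C_infinity h \<Longrightarrow> C_infinity (\<lambda>p. snd (h p))"
  by (rule C_infinity_compose[OF C_infinity_bounded_linear[OF bounded_linear_snd]])

lemma C_infinity_id: "C_infinity (\<lambda>p. p)"
  by (rule C_infinity_bounded_linear) (rule bounded_linear_ident)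

lemma C_infinity_scaleR_const: "C_infinity g \<Longrightarrow> C_infinity (\<lambda>p. c *\<^sub>R g p)"
  by (rule C_infinity_scaleR[OF C_infinity_const])

lemma C_infinity_mult:
  fixes a b :: "'a::euclidean_space \<Rightarrow> real"
  shows "C_infinity a \<Longrightarrow> C_infinity b \<Longrightarrow> C_infinity (\<lambda>p. a p * b p)"
  using C_infinity_scaleR[of a b] by simp

lemma C_infinity_diff:
  fixes g h :: "'a::euclidean_space \<Rightarrow> 'b::real_normed_vector"
  shows "C_infinity g \<Longrightarrow> C_infinity h \<Longrightarrow> C_infinity (\<lambda>p. g p - h p)"
  using C_infinity_add[of g "\<lambda>p. (-1) *\<^sub>R h p"] C_infinity_scaleR_const[of h "-1"] by simp

lemmas C_infinity_intros =
  C_infinity_const C_infinity_id C_infinity_D C_infinity_sum C_infinity_scaleR C_infinity_mult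
  C_infinity_Pair C_infinity_fst C_infinity_snd C_infinity_add C_infinity_diff

lemma C_infinity_imp_C_class: "C_infinity g \<Longrightarrow> C_class k g"
  by (simp add: C_infinity_def)

lemma C_infinity_has_derivative: "C_infinity g \<Longrightarrow> (g has_derivative (\<lambda>v. D v g p)) (at p)"
  by (rule C_class_has_derivative[where k = 0]) (rule C_infinity_imp_C_class)

lemma C_infinity_differentiable: "C_infinity g \<Longrightarrow> g differentiable (at p)"
  by (rule C_class_differentiable[where k = 0]) (rule C_infinity_imp_C_class)

lemma C_infinity_continuous_on: "C_infinity g \<Longrightarrow> continuous_on X h \<Longrightarrow> continuous_on X (\<lambda>x. g (h x))"
  using continuous_on_compose2[OF C_class_continuous[OF C_infinity_imp_C_class[where k = 0]]] by blast

lemma C_infinity_has_vector_derivative: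
  "C_infinity g \<Longrightarrow> (h has_vector_derivative h') (at t) \<Longrightarrow>
    ((\<lambda>s. g (h s)) has_vector_derivative D h' g (h t)) (at t)"
  by (rule C_class_has_vector_derivative[where k = 0, OF C_infinity_imp_C_class])

lemma D_C_infinity_add:
  "C_infinity g \<Longrightarrow> C_infinity h \<Longrightarrow> D v (\<lambda>p. g p + h p) = (\<lambda>p. D v g p + D v h p)"
  by (intro ext D_eqI has_derivative_add C_infinity_has_derivative)

lemma D_C_infinity_sum:
  "(\<And>i. i \<in> I \<Longrightarrow> C_infinity (g i)) \<Longrightarrow> D v (\<lambda>p. \<Sum>i\<in>I. g i p) = (\<lambda>p. \<Sum>i\<in>I. D v (g i) p)"
  by (intro ext D_eqI has_derivative_sum C_infinity_has_derivative)

lemma D_C_infinity_scaleR: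
  fixes a :: "'a::euclidean_space \<Rightarrow> real"
  shows "C_infinity a \<Longrightarrow> C_infinity g \<Longrightarrow> D v (\<lambda>p. a p *\<^sub>R g p) = (\<lambda>p. a p *\<^sub>R D v g p + D v a p *\<^sub>R g p)"
  by (intro ext D_eqI has_derivative_scaleR C_infinity_has_derivative)

lemma D_C_infinity_scaleR_const: "C_infinity g \<Longrightarrow> D v (\<lambda>p. c *\<^sub>R g p) = (\<lambda>p. c *\<^sub>R D v g p)"
  by (intro ext D_eqI has_derivative_scaleR_right C_infinity_has_derivative)

lemma D_C_infinity_compose_affine:
  "C_infinity g \<Longrightarrow> (\<And>p. (h has_derivative L) (at p)) \<Longrightarrow> D v (\<lambda>p. g (h p)) = (\<lambda>p. D (L v) g (h p))"
  by (rule D_compose_affine[where k = 0, OF C_infinity_imp_C_class])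

lemma D_C_infinity_commute:
  fixes g :: "'a::euclidean_space \<Rightarrow> 'c::banach"
  shows "C_infinity g \<Longrightarrow> D v (D w g) = D w (D v g)"
  by (rule ext) (rule D_commute[OF C_infinity_imp_C_class])

section \<open>Uniqueness for the wave equation\<close>

text \<open>The truncated power vanishes for nonpositive arguments. Composed with a suitable
  quadratic it confines integrals over a box to a ball or a cone, and for a > 1 it is C^1 across the
  edge.\<close>

definition bump :: "real \<Rightarrow> real \<Rightarrow> real" where
  "bump a y = max 0 y powr a"

lemma bump_nonneg: "bump a y \<ge> 0"
  by (simp add: bump_def)

lemma bump_eq_0: "y \<le> 0 \<Longrightarrow> bump a y = 0"
  by (simp add: bump_def)

lemma bump_pos: "y > 0 \<Longrightarrow> bump a y > 0"
  by (simp add: bump_def)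

lemma bump_add_one: "bump (a + 1) y = y * bump a y"
  by (auto simp: bump_def powr_add max_def)

lemma continuous_on_bump [continuous_intros]:
  "a > 0 \<Longrightarrow> continuous_on X g \<Longrightarrow> continuous_on X (\<lambda>x. bump a (g x))"
  unfolding bump_def by (intro continuous_on_powr' continuous_intros) auto

lemma bump_has_real_derivative:
  assumes "a > 1"
  shows "(bump a has_real_derivative a * bump (a - 1) y) (at y)"
proof -
  consider "y > 0" | "y < 0" | "y = 0" by linarith
  then show ?thesis
  proof cases
    case 1
    have "((\<lambda>z. z powr a) has_real_derivative a * bump (a - 1) y) (at y)"
      using has_real_derivative_powr[OF 1, of a] 1 by (simp add: bump_def)
    then show ?thesis
      by (rule has_field_derivative_transform_within_open[of _ _ _ "{0<..}"])
        (use 1 in \<open>auto simp: bump_def\<close>)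
  next
    case 2
    have "((\<lambda>_. 0) has_real_derivative a * bump (a - 1) y) (at y)"
      using 2 by (simp add: bump_def)
    then show ?thesis
      by (rule has_field_derivative_transform_within_open[of _ _ _ "{..<0}"])
        (use 2 in \<open>auto simp: bump_def\<close>)
  next
    case 3
    have "continuous_on UNIV (bump (a - 1))"
      using assms by (auto intro!: continuous_on_bump[of _ _ "\<lambda>x. x"] continuous_intros)
    then have "isCont (bump (a - 1)) 0"
      by (simp add: continuous_on_eq_continuous_at)
    then have "bump (a - 1) \<midarrow>0\<rightarrow> a * bump (a - 1) 0"
      by (simp add: isCont_def bump_def)
    \<comment> \<open>By \<open>bump_add_one\<close> the difference quotient at 0 is
      \<open>bump (a - 1)\<close> itself, whose limit at 0 is its value 0 because a - 1 > 0.\<close>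
    moreover have "bump (a - 1) h = (bump a (0 + h) - bump a 0) / h" if "h \<noteq> 0" for h
      using that bump_add_one[of "a - 1" h] by (simp add: bump_def)
    ultimately show ?thesis
      unfolding 3 DERIV_def by (subst (asm) LIM_equal) auto
  qed
qed

lemma bump_has_derivative:
  assumes "a > 1" "(g has_derivative g') (at x)"
  shows "((\<lambda>x. bump a (g x)) has_derivative (\<lambda>v. a * bump (a - 1) (g x) * g' v)) (at x)"
  using has_derivative_compose[OF assms(2), of "bump a" "\<lambda>v. a * bump (a - 1) (g x) * v"]
    bump_has_real_derivative[OF assms(1), of "g x"]
  by (simp add: has_field_derivative_def)

text \<open>The integral of the translate \<open>\<phi> (z + s *\<^sub>R v)\<close> over the box
  does not depend on s while the support stays inside, and its derivative at s = 0 is the integral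
  in question. The margin 1 between ball and box leaves room for the translation. This replaces the
  divergence theorem throughout.\<close>

lemma integral_directional_derivative_eq_0:
  fixes \<phi> :: "'a::euclidean_space \<Rightarrow> 'b::banach"
  assumes der: "\<And>z. (\<phi> has_derivative \<phi>' z) (at z)"
    and cont: "continuous_on UNIV (\<lambda>z. \<phi>' z v)"
    and supp: "\<And>z. z \<notin> cball c R \<Longrightarrow> \<phi> z = 0"
    and sub: "cball c (R + 1) \<subseteq> cbox a b"
  shows "integral (cbox a b) (\<lambda>z. \<phi>' z v) = 0"
proof -
  define I where "I = (\<lambda>s. integral (cbox a b) (\<lambda>z. \<phi> (z + s *\<^sub>R v)))"
  have contphi: "continuous_on UNIV \<phi>"
    using der by (meson continuous_on_eq_continuous_at has_derivative_continuous open_UNIV)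
  have dI: "(I has_vector_derivative integral (cbox a b) (\<lambda>z. \<phi>' (z + 0 *\<^sub>R v) v)) (at 0 within UNIV)"
    unfolding I_def
  proof (rule leibniz_rule_vector_derivative)
    show "((\<lambda>s. \<phi> (z + s *\<^sub>R v)) has_vector_derivative \<phi>' (z + s *\<^sub>R v) v) (at s within UNIV)" for s z
      by (rule has_vector_derivative_chain[OF _ der]) (auto intro!: derivative_eq_intros)
    show "(\<lambda>z. \<phi> (z + s *\<^sub>R v)) integrable_on cbox a b" for s
      by (intro integrable_continuous continuous_on_compose2[OF contphi] continuous_intros) auto
    show "continuous_on (UNIV \<times> cbox a b) (\<lambda>(s, z). \<phi>' (z + s *\<^sub>R v) v)"
      unfolding split_beta
      by (intro continuous_on_compose2[OF cont] continuous_intros) auto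
  qed auto
  \<comment> \<open>Chosen so that |s| < \<open>\<delta>\<close> moves points by at most the margin
    1; the 1 in the denominator covers v = 0.\<close>
  define \<delta> where "\<delta> = 1 / (1 + norm v)"
  have "\<delta> > 0" unfolding \<delta>_def by (simp add: add_pos_nonneg)
  have "I s = integral UNIV \<phi>" if "\<bar>s\<bar> < \<delta>" for s
  proof -
    have "\<bar>s\<bar> * (1 + norm v) \<le> 1"
      using that unfolding \<delta>_def by (simp add: pos_less_divide_eq add_pos_nonneg)
    then have nsv: "norm (s *\<^sub>R v) \<le> 1"
      by (simp add: algebra_simps)
    have mem: "x - s *\<^sub>R v \<in> cbox a b" if "x \<in> cball c R" for x
    proof -
      have "dist c (x - s *\<^sub>R v) \<le> dist c x + norm (s *\<^sub>R v)"
        unfolding dist_norm using norm_triangle_ineq[of "c - x" "s *\<^sub>R v"] by (simp add: algebra_simps)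
      with that nsv have "x - s *\<^sub>R v \<in> cball c (R + 1)" by simp
      with sub show ?thesis by blast
    qed
    have "I s = integral (cbox a b) (\<phi> \<circ> (+) (s *\<^sub>R v))"
      unfolding I_def by (simp add: o_def add.commute)
    also have "\<dots> = integral (cbox (a + s *\<^sub>R v) (b + s *\<^sub>R v)) \<phi>"
      by (rule integral_shift_cbox_plus)
    also have "\<dots> = integral UNIV (\<lambda>x. if x \<in> cbox (a + s *\<^sub>R v) (b + s *\<^sub>R v) then \<phi> x else 0)"
      by (rule Henstock_Kurzweil_Integration.integral_restrict_UNIV[symmetric])
    also have "(\<lambda>x. if x \<in> cbox (a + s *\<^sub>R v) (b + s *\<^sub>R v) then \<phi> x else 0) = \<phi>"
    proof
      fix x
      have "x \<in> cbox (a + s *\<^sub>R v) (b + s *\<^sub>R v)" if "x \<in> cball c R"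
        using mem[OF that] by (auto simp: mem_box algebra_simps)
      then show "(if x \<in> cbox (a + s *\<^sub>R v) (b + s *\<^sub>R v) then \<phi> x else 0) = \<phi> x"
        using supp by auto
    qed
    finally show ?thesis .
  qed
  then have "(I has_vector_derivative 0) (at 0)"
    by (intro has_vector_derivative_transform_within[OF has_vector_derivative_const[of "integral UNIV \<phi>"] \<open>\<delta> > 0\<close>])
      (auto simp: dist_real_def)
  with dI show ?thesis
    using vector_derivative_unique_at by fastforce
qed

lemma cball_subset_cbox_One:
  fixes c :: "'a::euclidean_space"
  shows "cball c R \<subseteq> cbox (c - R *\<^sub>R One) (c + R *\<^sub>R One)"
proof
  fix x assume "x \<in> cball c R"
  then have "\<bar>(x - c) \<bullet> i\<bar> \<le> R" if "i \<in> Basis" for i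
    using Basis_le_norm[OF that, of "x - c"] by (simp add: dist_norm norm_minus_commute)
  then show "x \<in> cbox (c - R *\<^sub>R One) (c + R *\<^sub>R One)"
    by (force simp: mem_box inner_diff_left inner_add_left abs_le_iff)
qed

section \<open>Energy estimate in a backward cone\<close>

text \<open>The energy density is integrated against a weight supported in the backward cone with
  apex \<open>(x0, T)\<close>. This weighted energy starts at 0 and cannot grow, so it vanishes;
  then \<open>D (0, 1) w\<close> is 0 on the segment from \<open>(x0, 0)\<close> to
  \<open>(x0, t0)\<close>, along which w keeps its initial value 0.\<close>

lemma wave_unique_forward:
  fixes w :: "'a::euclidean_space \<times> real \<Rightarrow> 'b::{real_inner, banach}"
  assumes w2: "C_class 2 w"
    and wave: "\<And>p. D (0, 1) (D (0, 1) w) p = (\<Sum>e\<in>Basis. D (e, 0) (D (e, 0) w) p)"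
    and w0: "\<And>x. w (x, 0) = 0" and wt0: "\<And>x. D (0, 1) w (x, 0) = 0"
    and "t0 \<ge> 0"
  shows "w (x0, t0) = 0"
proof -
  have w2': "C_class (Suc (Suc 0)) w" using w2 by (simp add: numeral_2_eq_2)
  have w1: "C_class (Suc 0) w" using w2' by (rule C_class_Suc_imp)
  have Dw1: "C_class (Suc 0) (D u w)" for u using w2' by (rule C_class_D)
  note dD = C_class_has_derivative[OF Dw1]
  have contD: "continuous_on UNIV (D u w)" for u by (rule C_class_continuous[OF Dw1])
  have contDD: "continuous_on UNIV (D u (D u' w))" for u u' by (rule C_class_continuous[OF C_class_D[OF Dw1]])
  note cD = continuous_on_compose2[OF contD _ subset_UNIV] continuous_on_compose2[OF contDD _ subset_UNIV]
  \<comment> \<open>The apex lies strictly above \<open>t0\<close>, so the weight is positive at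
    \<open>(x0, t)\<close> for all t up to \<open>t0\<close>.\<close>
  define T where "T = t0 + 1"
  have "T > 0" using \<open>t0 \<ge> 0\<close> by (simp add: T_def)
  \<comment> \<open>At times in [0, T] the cone has radius at most T; the extra 1 is the margin of
    \<open>integral_directional_derivative_eq_0\<close>.\<close>
  define B where "B = cbox (x0 - (T + 1) *\<^sub>R One) (x0 + (T + 1) *\<^sub>R One)"
  define y where "y = (\<lambda>p::'a \<times> real. (T - snd p)\<^sup>2 - (fst p - x0) \<bullet> (fst p - x0))"
  define y' where "y' = (\<lambda>(p::'a \<times> real) v. - 2 * (T - snd p) * snd v - 2 * ((fst p - x0) \<bullet> fst v))"
  \<comment> \<open>Exponent 2 makes the weight C^1: its derivative contains \<open>bump 1\<close>,
    which is still continuous.\<close>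
  define \<psi> where "\<psi> = (\<lambda>p. bump 2 (y p))"
  \<comment> \<open>Twice the usual energy density, |w_t|^2 + |grad w|^2.\<close>
  define e where "e = (\<lambda>p. D (0, 1) w p \<bullet> D (0, 1) w p + (\<Sum>i\<in>Basis. D (i, 0) w p \<bullet> D (i, 0) w p))"
  define e' where "e' = (\<lambda>p v. (D (0, 1) w p \<bullet> D v (D (0, 1) w) p + D v (D (0, 1) w) p \<bullet> D (0, 1) w p)
    + (\<Sum>i\<in>Basis. D (i, 0) w p \<bullet> D v (D (i, 0) w) p + D v (D (i, 0) w) p \<bullet> D (i, 0) w p))"
  have dy: "(y has_derivative y' p) (at p)" for p
    unfolding y_def y'_def by (auto intro!: derivative_eq_intros ext simp: inner_commute algebra_simps)
  have d\<psi>: "(\<psi> has_derivative (\<lambda>v. 2 * bump 1 (y p) * y' p v)) (at p)" for p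
    unfolding \<psi>_def using bump_has_derivative[OF _ dy, of 2] by simp
  have de: "(e has_derivative e' p) (at p)" for p
    unfolding e_def e'_def
    by (intro has_derivative_add has_derivative_sum has_derivative_inner dD)
  define F' where "F' = (\<lambda>p v. \<psi> p * e' p v + 2 * bump 1 (y p) * y' p v * e p)"
  have dF: "((\<lambda>p. \<psi> p * e p) has_derivative F' p) (at p)" for p
    unfolding F'_def by (intro has_derivative_mult d\<psi> de)
  have cy: "continuous_on X (\<lambda>x. y (g x))" if "continuous_on X g" for X and g :: "'x::topological_space \<Rightarrow> _"
    unfolding y_def by (intro continuous_intros that)
  have ce: "continuous_on X (\<lambda>x. e (g x))" if "continuous_on X g" for X and g :: "'x::topological_space \<Rightarrow> _"
    unfolding e_def by (intro continuous_intros cD that)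
  have c\<psi>: "continuous_on X (\<lambda>x. \<psi> (g x))" if "continuous_on X g" for X and g :: "'x::topological_space \<Rightarrow> _"
    unfolding \<psi>_def by (intro continuous_intros cy that) auto
  have cF': "continuous_on X (\<lambda>x. F' (g x) v)" if "continuous_on X g" for X v and g :: "'x::topological_space \<Rightarrow> _"
    unfolding F'_def e'_def y'_def by (intro continuous_intros cy cD c\<psi> ce that) auto
  define E where "E = (\<lambda>t. integral B (\<lambda>z. \<psi> (z, t) * e (z, t)))"
  have dE: "(E has_vector_derivative integral B (\<lambda>z. F' (z, t) (0, 1))) (at t within UNIV)" for t
    unfolding E_def B_def
  proof (rule leibniz_rule_vector_derivative)
    show "((\<lambda>s. \<psi> (z, s) * e (z, s)) has_vector_derivative F' (z, s) (0, 1)) (at s within UNIV)" for s z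
      by (rule has_vector_derivative_chain[OF _ dF]) (auto intro!: derivative_eq_intros)
    show "(\<lambda>z. \<psi> (z, s) * e (z, s)) integrable_on cbox (x0 - (T + 1) *\<^sub>R One) (x0 + (T + 1) *\<^sub>R One)" for s
      by (intro integrable_continuous continuous_intros c\<psi> ce)
    show "continuous_on (UNIV \<times> cbox (x0 - (T + 1) *\<^sub>R One) (x0 + (T + 1) *\<^sub>R One)) (\<lambda>(s, z). F' (z, s) (0, 1))"
      unfolding split_beta by (intro cF' continuous_intros)
  qed auto
  \<comment> \<open>Derivative in direction v of the weighted energy flux in direction i. Taken in
    its own direction \<open>(i, 0)\<close> it has integral 0 over the box, so multiples of it may
    be subtracted under the integral.\<close>
  define J where "J = (\<lambda>i p v. \<psi> p * (D (0, 1) w p \<bullet> D v (D (i, 0) w) p + D v (D (0, 1) w) p \<bullet> D (i, 0) w p)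
      + 2 * bump 1 (y p) * y' p v * (D (0, 1) w p \<bullet> D (i, 0) w p))"
  have dJ: "((\<lambda>p. \<psi> p * (D (0, 1) w p \<bullet> D (i, 0) w p)) has_derivative J i p) (at p)" for i p
    unfolding J_def by (intro has_derivative_mult has_derivative_inner d\<psi> dD)
  have cJ: "continuous_on X (\<lambda>x. J i (g x) v)" if "continuous_on X g" for X v i and g :: "'x::topological_space \<Rightarrow> _"
    unfolding J_def y'_def by (intro continuous_intros cy cD c\<psi> that) auto
  have intJ: "integral B (\<lambda>z. J i (z, t) (i, 0)) = 0" if "t \<in> {0..T}" for i t
    unfolding B_def
  proof (rule integral_directional_derivative_eq_0[where \<phi>' = "\<lambda>z v. J i (z, t) (v, 0)" and c = x0 and R = T])
    show "((\<lambda>z. \<psi> (z, t) * (D (0, 1) w (z, t) \<bullet> D (i, 0) w (z, t))) has_derivative (\<lambda>v. J i (z, t) (v, 0))) (at z)" for z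
      by (rule has_derivative_compose[OF _ dJ]) (auto intro!: derivative_eq_intros)
    show "continuous_on UNIV (\<lambda>z. J i (z, t) (i, 0))"
      by (intro cJ continuous_intros)
    show "\<psi> (z, t) * (D (0, 1) w (z, t) \<bullet> D (i, 0) w (z, t)) = 0" if "z \<notin> cball x0 T" for z
    proof -
      have "(T - t)\<^sup>2 \<le> (norm (z - x0))\<^sup>2"
        using that \<open>t \<in> {0..T}\<close> by (intro power_mono) (auto simp: dist_norm norm_minus_commute)
      then have "y (z, t) \<le> 0"
        by (simp add: y_def power2_norm_eq_inner)
      then show ?thesis by (simp add: \<psi>_def bump_eq_0)
    qed
    show "cball x0 (T + 1) \<subseteq> cbox (x0 - (T + 1) *\<^sub>R One) (x0 + (T + 1) *\<^sub>R One)"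
      by (rule cball_subset_cbox_One)
  qed
  \<comment> \<open>After subtracting twice the divergence of the flux, all second derivatives
    cancel by the wave equation. What remains comes from the derivative of the weight and has a sign
    because the cone has slope 1.\<close>
  have pointwise: "F' p (0, 1) - 2 * (\<Sum>i\<in>Basis. J i p (i, 0)) \<le> 0" if "snd p \<le> T" for p
  proof -
    define \<tau> where "\<tau> = T - snd p"
    define \<xi> where "\<xi> = fst p - x0"
    define a where "a = D (0, 1) w p"
    define c where "c = (\<lambda>i. D (i, 0) w p)"
    define S where "S = (\<Sum>i\<in>Basis. (\<xi> \<bullet> i) * (a \<bullet> c i))"
    have comm: "D (0, 1) (D (i, 0) w) p = D (i, 0) (D (0, 1) w) p" for i
      by (rule D_commute[OF w2])
    have folds: "D (0, 1) w p = a" "D (i, 0) w p = c i" for i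
      by (simp_all add: a_def c_def)
    have eF: "e' p (0, 1) = (\<Sum>i\<in>Basis. 2 * (a \<bullet> D (i, 0) (D (i, 0) w) p)) + (\<Sum>i\<in>Basis. 2 * (c i \<bullet> D (i, 0) (D (0, 1) w) p))"
      unfolding e'_def wave comm folds
      by (simp add: inner_sum_right inner_sum_left sum_distrib_left sum.distrib inner_commute[of "D _ _ _"])
    have eJ: "(\<Sum>i\<in>Basis. J i p (i, 0)) = (\<psi> p / 2) * e' p (0, 1) - 4 * bump 1 (y p) * S"
      unfolding eF S_def sum_distrib_left sum.distrib[symmetric] sum_subtractf[symmetric]
    proof (rule sum.cong[OF refl])
      fix i :: 'a
      have "J i p (i, 0) = \<psi> p * (a \<bullet> D (i, 0) (D (i, 0) w) p + c i \<bullet> D (i, 0) (D (0, 1) w) p)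
          + 2 * bump 1 (y p) * (- 2 * (\<xi> \<bullet> i)) * (a \<bullet> c i)"
        by (simp add: J_def y'_def folds \<xi>_def inner_commute[of _ "c i"])
      then show "J i p (i, 0) = (\<psi> p / 2) * (2 * (a \<bullet> D (i, 0) (D (i, 0) w) p) + 2 * (c i \<bullet> D (i, 0) (D (0, 1) w) p))
          - 4 * bump 1 (y p) * ((\<xi> \<bullet> i) * (a \<bullet> c i))"
        by (simp add: algebra_simps)
    qed
    have "F' p (0, 1) - 2 * (\<Sum>i\<in>Basis. J i p (i, 0)) = - 4 * bump 1 (y p) * (\<tau> * e p - 2 * S)"
      unfolding eJ F'_def y'_def \<tau>_def by (simp add: algebra_simps)
    moreover have "bump 1 (y p) * (\<tau> * e p - 2 * S) \<ge> 0"
    proof (cases "y p > 0")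
      case True
      then have y: "\<xi> \<bullet> \<xi> < \<tau>\<^sup>2" by (simp add: y_def \<xi>_def \<tau>_def)
      then have "\<tau> \<noteq> 0" by (metis inner_ge_zero not_less zero_power2)
      with that have "\<tau> > 0" by (simp add: \<tau>_def)
      \<comment> \<open>This sum of squares takes the place of the Cauchy-Schwarz bound for
        \<open>S\<close>. Expanded, and with |xi| < tau inside the cone, it gives tau times the
        required inequality.\<close>
      have "0 \<le> (\<Sum>i\<in>Basis. (\<tau> *\<^sub>R c i - (\<xi> \<bullet> i) *\<^sub>R a) \<bullet> (\<tau> *\<^sub>R c i - (\<xi> \<bullet> i) *\<^sub>R a))"
        by (intro sum_nonneg) simp
      also have "\<dots> = \<tau>\<^sup>2 * (\<Sum>i\<in>Basis. c i \<bullet> c i) - 2 * \<tau> * S + (\<Sum>i\<in>Basis. (\<xi> \<bullet> i) * (\<xi> \<bullet> i)) * (a \<bullet> a)"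
        unfolding S_def sum_distrib_left sum_distrib_right sum.distrib[symmetric] sum_subtractf[symmetric]
        by (rule sum.cong) (auto simp: algebra_simps inner_commute power2_eq_square)
      also have "(\<Sum>i\<in>Basis. (\<xi> \<bullet> i) * (\<xi> \<bullet> i)) = \<xi> \<bullet> \<xi>"
        by (rule euclidean_inner[symmetric])
      also have "\<xi> \<bullet> \<xi> * (a \<bullet> a) \<le> \<tau>\<^sup>2 * (a \<bullet> a)"
        using y by (intro mult_right_mono) auto
      finally have "0 \<le> \<tau> * (\<tau> * e p - 2 * S)"
        by (simp add: e_def a_def c_def algebra_simps power2_eq_square)
      with \<open>\<tau> > 0\<close> have "0 \<le> \<tau> * e p - 2 * S"
        by (simp add: zero_le_mult_iff)
      then show ?thesis by (simp add: bump_nonneg)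
    qed (simp add: bump_eq_0)
    ultimately show ?thesis by simp
  qed
  have E'_nonpos: "integral B (\<lambda>z. F' (z, t) (0, 1)) \<le> 0" if "t \<in> {0..T}" for t
  proof -
    have iJ: "(\<lambda>z. J i (z, t) (i, 0)) integrable_on B" for i
      unfolding B_def by (intro integrable_continuous cJ continuous_intros)
    have iF: "(\<lambda>z. F' (z, t) (0, 1)) integrable_on B"
      unfolding B_def by (intro integrable_continuous cF' continuous_intros)
    have "integral B (\<lambda>z. F' (z, t) (0, 1) - 2 * (\<Sum>i\<in>Basis. J i (z, t) (i, 0)))
      = integral B (\<lambda>z. F' (z, t) (0, 1)) - 2 * (\<Sum>i\<in>Basis. integral B (\<lambda>z. J i (z, t) (i, 0)))"
      by (simp add: integral_diff integral_sum integrable_sum iJ iF)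
    also have "\<dots> = integral B (\<lambda>z. F' (z, t) (0, 1))"
      by (simp add: intJ[OF that])
    finally have "integral B (\<lambda>z. F' (z, t) (0, 1))
      = integral B (\<lambda>z. F' (z, t) (0, 1) - 2 * (\<Sum>i\<in>Basis. J i (z, t) (i, 0)))" ..
    also have "\<dots> \<le> integral B (\<lambda>z. 0)"
      by (rule integral_le) (use pointwise that in \<open>auto intro!: integrable_diff integrable_sum integrable_0 iJ iF\<close>)
    finally show ?thesis by simp
  qed
  have e0: "e (x, 0) = 0" for x
  proof -
    have "D (i, 0) w (x, 0) = 0" for i
    proof -
      have "((\<lambda>s. w (x + s *\<^sub>R i, 0)) has_vector_derivative D (i, 0) w (x + 0 *\<^sub>R i, 0)) (at 0)"
        by (rule C_class_has_vector_derivative[OF w1]) (auto intro!: derivative_eq_intros)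
      then show ?thesis
        using vector_derivative_unique_at[OF _ has_vector_derivative_const[of 0]] by (simp add: w0)
    qed
    then show ?thesis by (simp add: e_def wt0)
  qed
  have wt: "D (0, 1) w (x0, t) = 0" if "t \<in> {0..t0}" for t
  proof -
    have tT: "0 \<le> t" "t < T" using that by (auto simp: T_def)
    have "E t \<le> E 0"
    proof (rule DERIV_nonpos_imp_nonincreasing[OF tT(1)])
      fix s assume "0 \<le> s" "s \<le> t"
      then show "\<exists>y. (E has_real_derivative y) (at s) \<and> y \<le> 0"
        using dE[of s] E'_nonpos[of s] tT
        by (auto simp: has_real_derivative_iff_has_vector_derivative)
    qed
    also have "E 0 = 0"
      by (simp add: E_def e0)
    finally have "E t \<le> 0" .
    have nonneg: "\<psi> q * e q \<ge> 0" for q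
      by (simp add: \<psi>_def e_def bump_nonneg sum_nonneg)
    have "E t \<ge> 0"
      unfolding E_def B_def
      by (intro integral_nonneg integrable_continuous continuous_intros c\<psi> ce nonneg)
    with \<open>E t \<le> 0\<close> have "E t = 0" by simp
    moreover have "box (x0 - (T + 1) *\<^sub>R One) (x0 + (T + 1) *\<^sub>R One) \<noteq> {}"
      using \<open>T > 0\<close> by (auto simp: box_ne_empty inner_diff_left inner_add_left)
    ultimately have "\<forall>x \<in> B. \<psi> (x, t) * e (x, t) = 0"
      unfolding E_def B_def
      by (subst (asm) integral_cbox_eq_0_iff) (auto intro!: continuous_intros c\<psi> ce nonneg)
    moreover have "x0 \<in> B"
      using \<open>T > 0\<close> by (auto simp: B_def mem_box inner_diff_left inner_add_left)
    moreover have "\<psi> (x0, t) > 0"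
      using tT by (simp add: \<psi>_def y_def bump_pos)
    ultimately have "e (x0, t) = 0"
      by (metis less_numeral_extra(3) mult_eq_0_iff)
    moreover have "e (x0, t) \<ge> D (0, 1) w (x0, t) \<bullet> D (0, 1) w (x0, t)"
      by (simp add: e_def sum_nonneg)
    ultimately show ?thesis
      by (metis inner_gt_zero_iff not_le)
  qed
  have "((\<lambda>s. w (x0, s)) has_vector_derivative 0) (at t within {0..t0})" if "t \<in> {0..t0}" for t
  proof -
    have "((\<lambda>s. w (x0, s)) has_vector_derivative D (0, 1) w (x0, t)) (at t)"
      by (rule C_class_has_vector_derivative[OF w1]) (auto intro!: derivative_eq_intros)
    then show ?thesis
      by (simp add: wt[OF that] has_vector_derivative_at_within)
  qed
  then obtain k where "\<And>s. s \<in> {0..t0} \<Longrightarrow> w (x0, s) = k"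
    using has_vector_derivative_zero_constant[of "{0..t0}" "\<lambda>s. w (x0, s)"] by auto
  from this[of 0] this[of t0] show ?thesis
    using w0 \<open>t0 \<ge> 0\<close> by simp
qed

text \<open>The reflection \<open>R\<close> of time preserves both the wave equation, which contains
  two time derivatives, and the zero data, so negative times reduce to positive ones.\<close>

lemma wave_unique:
  fixes w :: "'a::euclidean_space \<times> real \<Rightarrow> 'b::{real_inner, banach}"
  assumes w2: "C_class 2 w"
    and wave: "\<And>p. D (0, 1) (D (0, 1) w) p = (\<Sum>e\<in>Basis. D (e, 0) (D (e, 0) w) p)"
    and w0: "\<And>x. w (x, 0) = 0" and wt0: "\<And>x. D (0, 1) w (x, 0) = 0"
  shows "w (x, t) = 0"
proof (cases "t \<ge> 0")
  case True
  then show ?thesis using wave_unique_forward[OF w2 wave w0 wt0] by blast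
next
  case False
  define R where "R = (\<lambda>(x::'a, t::real). (x, - t))"
  have R: "bounded_linear R"
    unfolding R_def split_beta by (intro bounded_linear_intros bounded_linear_minus)
  have w2': "C_class (Suc (Suc 0)) w" using w2 by (simp add: numeral_2_eq_2)
  have Dw1: "C_class (Suc 0) (D u w)" for u using w2' by (rule C_class_D)
  have w1: "C_class (Suc 0) w" using w2' by (rule C_class_Suc_imp)
  define w' where "w' = (\<lambda>p. w (R p))"
  have D1: "D v w' = (\<lambda>p. D (R v) w (R p))" for v
    unfolding w'_def by (rule D_compose_affine[OF w1 bounded_linear_imp_has_derivative[OF R]])
  have D2: "D v (D v w') = (\<lambda>p. D (R v) (D (R v) w) (R p))" for v
    unfolding D1 by (rule D_compose_affine[OF Dw1 bounded_linear_imp_has_derivative[OF R]])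
  have m1: "D (0, -1) w = (\<lambda>p. - D (0, 1) w p)"
    using D_scaleR[OF C_class_differentiable[OF w1], of "-1" "(0, 1)"] by fastforce
  have "D (0, -1) (D (0, -1) w) p = D (0, 1) (D (0, 1) w) p" for p
  proof -
    have "D (0, -1) (D (0, -1) w) p = - D (0, -1) (D (0, 1) w) p"
      unfolding m1 by (rule D_eqI[OF has_derivative_minus[OF C_class_has_derivative[OF Dw1]]])
    also have "D (0, -1) (D (0, 1) w) p = - D (0, 1) (D (0, 1) w) p"
      using D_scaleR[OF C_class_differentiable[OF Dw1], of "-1" "(0, 1)" "(0, 1)" p] by simp
    finally show ?thesis by simp
  qed
  then have wave': "D (0, 1) (D (0, 1) w') p = (\<Sum>e\<in>Basis. D (e, 0) (D (e, 0) w') p)" for p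
    unfolding D2 by (simp add: R_def split_beta wave)
  have "w' (x, - t) = 0"
  proof (rule wave_unique_forward[OF _ wave'])
    show "C_class 2 w'"
      unfolding w'_def by (intro C_class_compose[OF w2] C_class_bounded_linear R)
    show "w' (x, 0) = 0" "D (0, 1) w' (x, 0) = 0" for x
      by (simp_all add: D1, simp_all add: m1 R_def w'_def w0 wt0)
  qed (use False in simp)
  then show ?thesis by (simp add: w'_def R_def)
qed

section \<open>Smooth solutions of the wave equation\<close>

text \<open>The sum runs over the basis of the small space 'a, embedded by \<open>\<iota>\<close> in
  'c. Coordinates of 'c outside the image, such as b, then act as parameters.\<close>

definition lap :: "('a::euclidean_space \<Rightarrow> 'c::euclidean_space) \<Rightarrow> ('c \<Rightarrow> 'b::real_normed_vector) \<Rightarrow> 'c \<Rightarrow> 'b" where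
  "lap \<iota> g = (\<lambda>q. \<Sum>e\<in>Basis. D (\<iota> e) (D (\<iota> e) g) q)"

lemma C_infinity_lap: "C_infinity g \<Longrightarrow> C_infinity (lap \<iota> g)"
  unfolding lap_def by (intro C_infinity_intros)

lemma D_snd_scaleR:
  fixes g :: "'c::euclidean_space \<times> real \<Rightarrow> 'b::real_normed_vector"
  assumes "C_infinity g"
  shows "D (v, s) (\<lambda>q. snd q *\<^sub>R g q) = (\<lambda>q. snd q *\<^sub>R D (v, s) g q + s *\<^sub>R g q)"
proof -
  have "D (v, s) (snd :: 'c \<times> real \<Rightarrow> real) q = s" for q
    by (simp add: D_eqI[OF bounded_linear_imp_has_derivative[OF bounded_linear_snd]])
  then show ?thesis
    using D_C_infinity_scaleR[OF C_infinity_bounded_linear[OF bounded_linear_snd] assms] by simp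
qed

lemma lap_snd_scaleR:
  fixes g :: "'c::euclidean_space \<times> real \<Rightarrow> 'b::real_normed_vector"
  assumes "C_infinity g"
  shows "lap (\<lambda>e. (\<iota> e, 0)) (\<lambda>q. snd q *\<^sub>R g q) q = snd q *\<^sub>R lap (\<lambda>e. (\<iota> e, 0)) g q"
  unfolding lap_def by (simp add: D_snd_scaleR assms C_infinity_D scaleR_sum_right)

lemma lap_add:
  "C_infinity g \<Longrightarrow> C_infinity h \<Longrightarrow> lap \<iota> (\<lambda>q. g q + h q) q = lap \<iota> g q + lap \<iota> h q"
  unfolding lap_def by (simp add: D_C_infinity_add C_infinity_D sum.distrib)

lemma lap_scaleR_const:
  "C_infinity g \<Longrightarrow> lap \<iota> (\<lambda>q. c *\<^sub>R g q) q = c *\<^sub>R lap \<iota> g q"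
  unfolding lap_def by (simp add: D_C_infinity_scaleR_const C_infinity_D scaleR_sum_right)

lemma lap_D_commute:
  fixes g :: "'c::euclidean_space \<Rightarrow> 'b::banach"
  assumes "C_infinity g"
  shows "lap \<iota> (D v g) = D v (lap \<iota> g)"
  unfolding lap_def
  by (subst D_C_infinity_sum) (simp_all add: assms C_infinity_D D_C_infinity_commute[of g _ v] D_C_infinity_commute[of "D _ g" _ v])

text \<open>
  Euler--Poisson--Darboux equation \<open>Q\<^sub>T\<^sub>T + (\<kappa>/T) Q\<^sub>T = \<Delta>Q\<close>, multiplied by \<open>T\<close> to include \<open>T = 0\<close>.
\<close>
definition EPD :: "real \<Rightarrow> ('a::euclidean_space \<Rightarrow> 'c::euclidean_space) \<Rightarrow> ('c \<times> real \<Rightarrow> 'b::real_normed_vector) \<Rightarrow> bool" where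
  "EPD \<kappa> \<iota> Q \<longleftrightarrow> (\<forall>q. snd q *\<^sub>R D (0, 1) (D (0, 1) Q) q + \<kappa> *\<^sub>R D (0, 1) Q q = snd q *\<^sub>R lap (\<lambda>e. (\<iota> e, 0)) Q q)"

text \<open>For T > 0 this is \<open>T powr (2 - \<kappa>)\<close> times the T-derivative of
  \<open>T powr (\<kappa> - 1)\<close> times Q, written in the form that makes sense at T =
  0.\<close>

definition epd_lower :: "real \<Rightarrow> ('c::euclidean_space \<times> real \<Rightarrow> 'b::real_normed_vector) \<Rightarrow> 'c \<times> real \<Rightarrow> 'b" where
  "epd_lower \<kappa> Q = (\<lambda>q. (\<kappa> - 1) *\<^sub>R Q q + snd q *\<^sub>R D (0, 1) Q q)"

lemma C_infinity_epd_lower: "C_infinity Q \<Longrightarrow> C_infinity (epd_lower \<kappa> Q)"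
  unfolding epd_lower_def by (intro C_infinity_intros)

text \<open>The T-derivative of the lowered function is kappa Q_T + T Q_TT, exactly the left side of
  the equation for Q. Differentiating T times the Laplacian once more leaves an identity without an
  overall factor T, so for kappa = 2 the wave equation holds at T = 0 too.\<close>

lemma
  fixes Q :: "'c::euclidean_space \<times> real \<Rightarrow> 'b::banach"
  assumes Q: "C_infinity Q" and epd: "EPD \<kappa> \<iota> Q"
  shows D_epd_lower: "D (0, 1) (epd_lower \<kappa> Q) = (\<lambda>q. snd q *\<^sub>R lap (\<lambda>e. (\<iota> e, 0)) Q q)"
    and DD_epd_lower: "D (0, 1) (D (0, 1) (epd_lower \<kappa> Q)) q =
      lap (\<lambda>e. (\<iota> e, 0)) (epd_lower \<kappa> Q) q - (\<kappa> - 2) *\<^sub>R lap (\<lambda>e. (\<iota> e, 0)) Q q"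
proof -
  have e: "\<kappa> *\<^sub>R D (0, 1) Q q = snd q *\<^sub>R lap (\<lambda>e. (\<iota> e, 0)) Q q - snd q *\<^sub>R D (0, 1) (D (0, 1) Q) q" for q
    using epd unfolding EPD_def by (metis add_diff_cancel_left')
  have "D (0, 1) (epd_lower \<kappa> Q) q = (\<kappa> - 1) *\<^sub>R D (0, 1) Q q + (snd q *\<^sub>R D (0, 1) (D (0, 1) Q) q + D (0, 1) Q q)" for q
    unfolding epd_lower_def
    by (subst D_C_infinity_add)
      (auto simp: D_C_infinity_scaleR_const D_snd_scaleR Q C_infinity_intros C_infinity_scaleR_const)
  then show 1: "D (0, 1) (epd_lower \<kappa> Q) = (\<lambda>q. snd q *\<^sub>R lap (\<lambda>e. (\<iota> e, 0)) Q q)"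
    by (simp add: fun_eq_iff scaleR_diff_left e)
  have "lap (\<lambda>e. (\<iota> e, 0)) (epd_lower \<kappa> Q) q = (\<kappa> - 1) *\<^sub>R lap (\<lambda>e. (\<iota> e, 0)) Q q + snd q *\<^sub>R D (0, 1) (lap (\<lambda>e. (\<iota> e, 0)) Q) q" for q
    unfolding epd_lower_def
    by (subst lap_add)
      (auto simp: lap_scaleR_const lap_snd_scaleR lap_D_commute Q C_infinity_intros C_infinity_scaleR_const)
  then show "D (0, 1) (D (0, 1) (epd_lower \<kappa> Q)) q =
      lap (\<lambda>e. (\<iota> e, 0)) (epd_lower \<kappa> Q) q - (\<kappa> - 2) *\<^sub>R lap (\<lambda>e. (\<iota> e, 0)) Q q"
    unfolding 1 by (simp add: D_snd_scaleR C_infinity_lap Q scaleR_diff_left scaleR_2)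
qed

lemma EPD_epd_lower:
  fixes Q :: "'c::euclidean_space \<times> real \<Rightarrow> 'b::banach"
  assumes "C_infinity Q" "EPD \<kappa> \<iota> Q"
  shows "EPD (\<kappa> - 2) \<iota> (epd_lower \<kappa> Q)"
  unfolding EPD_def
proof
  fix q
  show "snd q *\<^sub>R D (0, 1) (D (0, 1) (epd_lower \<kappa> Q)) q + (\<kappa> - 2) *\<^sub>R D (0, 1) (epd_lower \<kappa> Q) q
    = snd q *\<^sub>R lap (\<lambda>e. (\<iota> e, 0)) (epd_lower \<kappa> Q) q"
    unfolding DD_epd_lower[OF assms, of q] fun_cong[OF D_epd_lower[OF assms], of q]
    by (simp add: algebra_simps)
qed

text \<open>Lowering k + 1 times takes kappa from 2 k + 2 to 0. Each lowering multiplies the values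
  at T = 0 by kappa - 1, and \<open>C\<close> is the product of these odd numbers. The velocity
  vanishes at T = 0 by the factor T in \<open>D_epd_lower\<close>.\<close>

lemma wave_from_EPD:
  fixes Q :: "'c::euclidean_space \<times> real \<Rightarrow> 'b::banach"
  assumes "C_infinity Q" "EPD (2 * real k + 2) \<iota> Q"
  shows "\<exists>(W :: 'c \<times> real \<Rightarrow> 'b) C. C_infinity W \<and> C > 0 \<and> (\<forall>q. D (0, 1) (D (0, 1) W) q = lap (\<lambda>e. (\<iota> e, 0)) W q) \<and>
    (\<forall>p. W (p, 0) = C *\<^sub>R Q (p, 0)) \<and> (\<forall>p. D (0, 1) W (p, 0) = 0)"
  using assms
proof (induction k arbitrary: Q)
  case 0
  then have Q: "C_infinity Q" "EPD 2 \<iota> Q" by simp_all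
  show ?case
  proof (intro exI conjI allI)
    show "C_infinity (epd_lower 2 Q)" by (rule C_infinity_epd_lower[OF Q(1)])
    show "(1::real) > 0" by simp
    show "D (0, 1) (D (0, 1) (epd_lower 2 Q)) q = lap (\<lambda>e. (\<iota> e, 0)) (epd_lower 2 Q) q" for q
      using DD_epd_lower[OF Q] by simp
    show "epd_lower 2 Q (p, 0) = 1 *\<^sub>R Q (p, 0)" for p by (simp add: epd_lower_def)
    show "D (0, 1) (epd_lower 2 Q) (p, 0) = 0" for p by (simp add: D_epd_lower[OF Q])
  qed
next
  case (Suc k)
  have "EPD (2 * real k + 2) \<iota> (epd_lower (2 * real (Suc k) + 2) Q)"
    using EPD_epd_lower[OF Suc.prems] by (simp add: algebra_simps)
  from Suc.IH[OF C_infinity_epd_lower[OF Suc.prems(1)] this] obtain W :: "'c \<times> real \<Rightarrow> 'b" and C where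
    W: "C_infinity W" "C > 0" "\<forall>q. D (0, 1) (D (0, 1) W) q = lap (\<lambda>e. (\<iota> e, 0)) W q"
      "\<forall>p. W (p, 0) = C *\<^sub>R epd_lower (2 * real (Suc k) + 2) Q (p, 0)" "\<forall>p. D (0, 1) W (p, 0) = 0"
    by blast
  \<comment> \<open>The new factor is kappa - 1 for kappa = 2 (k + 1) + 2.\<close>
  show ?case
    by (rule exI[of _ W], rule exI[of _ "C * (2 * real (Suc k) + 1)"])
      (use W in \<open>auto simp: epd_lower_def\<close>)
qed

section \<open>Weighted averages over the unit ball\<close>

text \<open>Coordinate 2 is the radius of the unit ball plus the margin 1 required by
  \<open>integral_directional_derivative_eq_0\<close>.\<close>

definition corner :: "'a::euclidean_space" where
  "corner = 2 *\<^sub>R One"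

lemma cball_subset_corner: "cball 0 (1 + 1) \<subseteq> cbox (- corner) (corner :: 'a::euclidean_space)"
  using cball_subset_cbox_One[of "0 :: 'a" 2] by (simp add: corner_def)

text \<open>The weight restricts the box to the unit ball. Scaling by T sits inside the argument of
  f rather than in the domain, so the integral is smooth for every real T. It is not normalised; the
  mass of the weight is divided out later.\<close>

definition wavg :: "('a::euclidean_space \<Rightarrow> 'c::euclidean_space) \<Rightarrow> real \<Rightarrow> ('c \<Rightarrow> 'b::banach) \<Rightarrow> 'c \<times> real \<Rightarrow> 'b" where
  "wavg \<iota> a f = (\<lambda>q. integral (cbox (- corner) corner)
     (\<lambda>z. bump a (1 - z \<bullet> z) *\<^sub>R f (fst q + snd q *\<^sub>R \<iota> z)))"

context
  fixes \<iota> :: "'a::euclidean_space \<Rightarrow> 'c::euclidean_space"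
  assumes \<iota>: "bounded_linear \<iota>"
begin

abbreviation (input) "supp_box \<equiv> cbox (- corner) (corner :: 'a)"

lemma C_infinity_shift:
  assumes "C_infinity f"
  shows "C_infinity (\<lambda>x. f (fst (fst x) + snd (fst x) *\<^sub>R \<iota> (snd x)))"
  by (intro C_infinity_compose[OF assms] C_infinity_intros C_infinity_compose[OF C_infinity_bounded_linear[OF \<iota>]])

lemma D_shift:
  assumes "C_infinity f"
  shows "D ((v, s), 0) (\<lambda>x. f (fst (fst x) + snd (fst x) *\<^sub>R \<iota> (snd x))) x
    = D (v + s *\<^sub>R \<iota> (snd x)) f (fst (fst x) + snd (fst x) *\<^sub>R \<iota> (snd x))"
proof (rule D_eqI[THEN trans])
  show "((\<lambda>x. f (fst (fst x) + snd (fst x) *\<^sub>R \<iota> (snd x))) has_derivative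
    (\<lambda>d. D (fst (fst d) + (snd (fst x) *\<^sub>R \<iota> (snd d) + snd (fst d) *\<^sub>R \<iota> (snd x))) f (fst (fst x) + snd (fst x) *\<^sub>R \<iota> (snd x)))) (at x)"
    by (rule has_derivative_compose[OF _ C_infinity_has_derivative[OF assms]])
      (auto intro!: derivative_eq_intros bounded_linear.has_derivative[OF \<iota>])
qed (simp add: linear_0[OF bounded_linear.linear[OF \<iota>]])

lemma continuous_on_weight: "a > 0 \<Longrightarrow> continuous_on X (\<lambda>z::'a. bump a (1 - z \<bullet> z))"
  by (intro continuous_intros) auto

lemma C_infinity_wavg:
  assumes "C_infinity f" "a > 0"
  shows "C_infinity (wavg \<iota> a f)"
  unfolding C_infinity_def
proof
  fix k
  show "C_class k (wavg \<iota> a f)"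
    using C_class_param_integral[OF C_infinity_imp_C_class[OF C_infinity_shift[OF assms(1)]] continuous_on_weight[OF assms(2)]]
    by (simp add: wavg_def)
qed

lemma D_wavg:
  assumes "C_infinity f" "a > 0"
  shows "D (v, s) (wavg \<iota> a f) q = integral supp_box (\<lambda>z. bump a (1 - z \<bullet> z) *\<^sub>R D (v + s *\<^sub>R \<iota> z) f (fst q + snd q *\<^sub>R \<iota> z))"
  using D_param_integral[OF C_infinity_imp_C_class[OF C_infinity_shift[OF assms(1)]] continuous_on_weight[OF assms(2)],
      where v = "(v, s)" and p = q, unfolded D_shift[OF assms(1)]]
  by (simp add: wavg_def)

lemma D_wavg_space:
  assumes "C_infinity f" "a > 0"
  shows "D (v, 0) (wavg \<iota> a f) = wavg \<iota> a (D v f)"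
  by (rule ext) (simp only: D_wavg[OF assms], simp add: wavg_def)

lemma continuous_on_shift:
  assumes "C_infinity f"
  shows "continuous_on X (\<lambda>z. f (p + T *\<^sub>R \<iota> z))"
  by (intro C_infinity_continuous_on[OF assms] continuous_intros bounded_linear.continuous_on[OF \<iota>])

lemma lap_wavg:
  assumes "C_infinity f" "a > 0"
  shows "lap (\<lambda>e. (\<iota> e, 0)) (wavg \<iota> a f) = wavg \<iota> a (lap \<iota> f)"
proof
  fix q
  have "(\<lambda>z. bump a (1 - z \<bullet> z) *\<^sub>R D (\<iota> e) (D (\<iota> e) f) (fst q + snd q *\<^sub>R \<iota> z)) integrable_on supp_box" for e
    by (intro integrable_continuous continuous_on_scaleR continuous_on_weight[OF assms(2)]
        continuous_on_shift[OF C_infinity_D[OF C_infinity_D[OF assms(1)]]])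
  then show "lap (\<lambda>e. (\<iota> e, 0)) (wavg \<iota> a f) q = wavg \<iota> a (lap \<iota> f) q"
    unfolding lap_def
    by (simp only: D_wavg_space assms C_infinity_D) (simp add: wavg_def scaleR_sum_right integral_sum)
qed

lemma C_infinity_shift_at:
  assumes "C_infinity f"
  shows "C_infinity (\<lambda>z. f (p + T *\<^sub>R \<iota> z))"
  by (intro C_infinity_compose[OF assms] C_infinity_intros C_infinity_compose[OF C_infinity_bounded_linear[OF \<iota>]])

lemma D_shift_at:
  assumes "C_infinity f"
  shows "D e (\<lambda>z. f (p + T *\<^sub>R \<iota> z)) z = T *\<^sub>R D (\<iota> e) f (p + T *\<^sub>R \<iota> z)"
proof -
  have "((\<lambda>z. p + T *\<^sub>R \<iota> z) has_derivative (\<lambda>v. T *\<^sub>R \<iota> v)) (at z)" for z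
    by (auto intro!: derivative_eq_intros bounded_linear.has_derivative[OF \<iota>])
  from D_C_infinity_compose_affine[OF assms this] show ?thesis
    by (simp add: D_scaleR[OF C_infinity_differentiable[OF assms]])
qed

lemma weight_has_derivative:
  assumes "a > 0"
  shows "((\<lambda>z::'a. bump (a + 1) (1 - z \<bullet> z)) has_derivative (\<lambda>v. - 2 * (a + 1) * (z \<bullet> v) * bump a (1 - z \<bullet> z))) (at z)"
proof -
  have "((\<lambda>z::'a. 1 - z \<bullet> z) has_derivative (\<lambda>v. - 2 * (z \<bullet> v))) (at z)"
    by (auto intro!: derivative_eq_intros simp: inner_commute)
  from bump_has_derivative[OF _ this, of "a + 1"] assms show ?thesis
    by (simp add: algebra_simps)
qed

lemma weight_eq_0:
  assumes "z \<notin> cball (0::'a) 1"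
  shows "bump a (1 - z \<bullet> z) = 0"
proof -
  have "1 \<le> (norm z)\<^sup>2" using assms by (simp add: power2_eq_1_iff one_le_power)
  then show ?thesis by (intro bump_eq_0) (simp add: power2_norm_eq_inner)
qed

text \<open>The gradient of (1 - |z|^2)^(a+1) is -2 (a+1) z (1 - |z|^2)^a. A factor
  \<open>z \<bullet> e\<close> under the weight of exponent a is thus traded for a derivative under
  the weight of exponent a + 1.\<close>

lemma integral_by_parts:
  fixes h :: "'a \<Rightarrow> 'b::banach"
  assumes h: "C_infinity h" and "a > 0"
  shows "integral supp_box (\<lambda>z. bump (a + 1) (1 - z \<bullet> z) *\<^sub>R D e h z)
    = (2 * (a + 1)) *\<^sub>R integral supp_box (\<lambda>z. bump a (1 - z \<bullet> z) *\<^sub>R (z \<bullet> e) *\<^sub>R h z)"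
proof -
  define \<phi>' where "\<phi>' = (\<lambda>z v. bump (a + 1) (1 - z \<bullet> z) *\<^sub>R D v h z
    + (- 2 * (a + 1) * (z \<bullet> v) * bump a (1 - z \<bullet> z)) *\<^sub>R h z)"
  note ch = C_infinity_continuous_on[OF h] C_infinity_continuous_on[OF C_infinity_D[OF h]]
  have "integral supp_box (\<lambda>z. \<phi>' z e) = 0"
  proof (rule integral_directional_derivative_eq_0)
    show "((\<lambda>z. bump (a + 1) (1 - z \<bullet> z) *\<^sub>R h z) has_derivative \<phi>' z) (at z)" for z
      unfolding \<phi>'_def
      by (intro has_derivative_scaleR weight_has_derivative C_infinity_has_derivative assms)
    show "continuous_on UNIV (\<lambda>z. \<phi>' z e)"
      unfolding \<phi>'_def
      by (intro continuous_intros continuous_on_weight ch) (use assms in auto)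
    show "bump (a + 1) (1 - z \<bullet> z) *\<^sub>R h z = 0" if "z \<notin> cball 0 1" for z
      by (simp add: weight_eq_0[OF that])
  qed (rule cball_subset_corner)
  moreover have "(\<lambda>z. bump (a + 1) (1 - z \<bullet> z) *\<^sub>R D e h z) integrable_on supp_box"
    by (intro integrable_continuous continuous_intros continuous_on_weight ch) (use assms in auto)
  moreover have "(\<lambda>z. bump a (1 - z \<bullet> z) *\<^sub>R (z \<bullet> e) *\<^sub>R h z) integrable_on supp_box"
    by (intro integrable_continuous continuous_intros continuous_on_weight ch) (use assms in auto)
  moreover have "\<phi>' z e = bump (a + 1) (1 - z \<bullet> z) *\<^sub>R D e h z
      - (2 * (a + 1)) *\<^sub>R (bump a (1 - z \<bullet> z) *\<^sub>R (z \<bullet> e) *\<^sub>R h z)" for z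
    unfolding \<phi>'_def by (simp add: algebra_simps)
  ultimately show ?thesis
    by (simp only: integral_diff integrable_cmul integral_cmul) simp
qed

lemma D_embed_sum:
  assumes "C_infinity f"
  shows "D (\<iota> z) f p = (\<Sum>e\<in>Basis. (z \<bullet> e) *\<^sub>R D (\<iota> e) f p)"
proof -
  have "linear (\<lambda>z. D (\<iota> z) f p)"
    using linear_compose[OF bounded_linear.linear[OF \<iota>] has_derivative_linear[OF C_infinity_has_derivative[OF assms]]]
    by (simp add: o_def)
  from linear_sum[OF this, of "\<lambda>e. (z \<bullet> e) *\<^sub>R e" Basis] linear_cmul[OF this]
  have "D (\<iota> (\<Sum>e\<in>Basis. (z \<bullet> e) *\<^sub>R e)) f p = (\<Sum>e\<in>Basis. (z \<bullet> e) *\<^sub>R D (\<iota> e) f p)"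
    by simp
  then show ?thesis
    by (simp add: euclidean_representation)
qed

text \<open>Differentiation in T brings down z dotted with the gradient of f. Integrating by parts
  in z removes the factor z, raises the exponent, and produces T times the Laplacian by the chain
  rule.\<close>

lemma D_time_wavg:
  fixes f :: "'c \<Rightarrow> 'd::banach"
  assumes f: "C_infinity f" and a: "a > 0"
  shows "D (0, 1) (wavg \<iota> a f) = (\<lambda>q. (1 / (2 * (a + 1))) *\<^sub>R snd q *\<^sub>R wavg \<iota> (a + 1) (lap \<iota> f) q)"
proof
  fix q :: "'c \<times> real"
  have a1: "a + 1 > 0" using a by simp
  let ?s = "\<lambda>z. fst q + snd q *\<^sub>R \<iota> z"
  have int1: "(\<lambda>z. bump b (1 - z \<bullet> z) *\<^sub>R (z \<bullet> e) *\<^sub>R g (?s z)) integrable_on supp_box"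
    if "C_infinity g" "b > 0" for g :: "'c \<Rightarrow> 'd::banach" and b e
    by (intro integrable_continuous continuous_intros continuous_on_weight[OF that(2)] continuous_on_shift[OF that(1)] that(2))
  have int2: "(\<lambda>z. bump b (1 - z \<bullet> z) *\<^sub>R g (?s z)) integrable_on supp_box"
    if "C_infinity g" "b > 0" for g :: "'c \<Rightarrow> 'd::banach" and b
    by (intro integrable_continuous continuous_intros continuous_on_weight[OF that(2)] continuous_on_shift[OF that(1)] that(2))
  have "(2 * (a + 1)) *\<^sub>R D (0, 1) (wavg \<iota> a f) q
      = (2 * (a + 1)) *\<^sub>R integral supp_box (\<lambda>z. \<Sum>e\<in>Basis. bump a (1 - z \<bullet> z) *\<^sub>R (z \<bullet> e) *\<^sub>R D (\<iota> e) f (?s z))"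
    unfolding D_wavg[OF assms]
  proof (intro arg_cong[of _ _ "\<lambda>F. _ *\<^sub>R integral supp_box F"] ext)
    fix z
    show "bump a (1 - z \<bullet> z) *\<^sub>R D (0 + 1 *\<^sub>R \<iota> z) f (?s z)
      = (\<Sum>e\<in>Basis. bump a (1 - z \<bullet> z) *\<^sub>R (z \<bullet> e) *\<^sub>R D (\<iota> e) f (?s z))"
      using D_embed_sum[OF f, of z "?s z"] by (simp add: scaleR_sum_right)
  qed
  also have "\<dots> = (\<Sum>e\<in>Basis. (2 * (a + 1)) *\<^sub>R integral supp_box (\<lambda>z. bump a (1 - z \<bullet> z) *\<^sub>R (z \<bullet> e) *\<^sub>R D (\<iota> e) f (?s z)))"
    by (simp only: integral_sum[OF finite_Basis int1[OF C_infinity_D[OF f] a]] scaleR_sum_right)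
  also have "\<dots> = (\<Sum>e\<in>Basis. integral supp_box (\<lambda>z. bump (a + 1) (1 - z \<bullet> z) *\<^sub>R snd q *\<^sub>R D (\<iota> e) (D (\<iota> e) f) (?s z)))"
    by (simp only: integral_by_parts[OF C_infinity_shift_at[OF C_infinity_D[OF f]] a, symmetric] D_shift_at[OF C_infinity_D[OF f]])
  also have "\<dots> = (\<Sum>e\<in>Basis. snd q *\<^sub>R integral supp_box (\<lambda>z. bump (a + 1) (1 - z \<bullet> z) *\<^sub>R D (\<iota> e) (D (\<iota> e) f) (?s z)))"
    by (simp only: scaleR_left_commute[of _ "snd q"] integral_cmul)
  also have "\<dots> = snd q *\<^sub>R wavg \<iota> (a + 1) (lap \<iota> f) q"
    unfolding wavg_def lap_def scaleR_sum_right
    by (simp only: scaleR_sum_right integral_sum[OF finite_Basis int2[OF C_infinity_D[OF C_infinity_D[OF f]] a1]])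
  finally have "(2 * (a + 1)) *\<^sub>R D (0, 1) (wavg \<iota> a f) q = snd q *\<^sub>R wavg \<iota> (a + 1) (lap \<iota> f) q" .
  then have "(1 / (2 * (a + 1))) *\<^sub>R (2 * (a + 1)) *\<^sub>R D (0, 1) (wavg \<iota> a f) q
      = (1 / (2 * (a + 1))) *\<^sub>R snd q *\<^sub>R wavg \<iota> (a + 1) (lap \<iota> f) q" by (rule arg_cong)
  then show "D (0, 1) (wavg \<iota> a f) q = (1 / (2 * (a + 1))) *\<^sub>R snd q *\<^sub>R wavg \<iota> (a + 1) (lap \<iota> f) q"
    using a by simp
qed

text \<open>This relation brings the exponent back from a + 1 to a. T times the T-derivative is the
  radial derivative in z of g(x + T z); it is integrated by parts against z (1 - |z|^2)^(a+1), whose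
  divergence follows from |z|^2 = 1 - (1 - |z|^2).\<close>

lemma D_time_wavg_radial:
  fixes g :: "'c \<Rightarrow> 'd::banach"
  assumes g: "C_infinity g" and a: "a > 0"
  shows "snd q *\<^sub>R D (0, 1) (wavg \<iota> (a + 1) g) q
    = (2 * (a + 1)) *\<^sub>R wavg \<iota> a g q - (real DIM('a) + 2 * (a + 1)) *\<^sub>R wavg \<iota> (a + 1) g q"
proof -
  let ?s = "\<lambda>z. fst q + snd q *\<^sub>R \<iota> z"
  have a1: "a + 1 > 0" using a by simp
  have int1: "(\<lambda>z. bump b (1 - z \<bullet> z) *\<^sub>R (z \<bullet> e) *\<^sub>R (z \<bullet> e) *\<^sub>R h (?s z)) integrable_on supp_box"
    if "C_infinity h" "b > 0" for h :: "'c \<Rightarrow> 'd::banach" and b e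
    by (intro integrable_continuous continuous_intros continuous_on_weight[OF that(2)] continuous_on_shift[OF that(1)] that(2))
  have int2: "(\<lambda>z. bump b (1 - z \<bullet> z) *\<^sub>R (z \<bullet> e) *\<^sub>R h (?s z)) integrable_on supp_box"
    if "C_infinity h" "b > 0" for h :: "'c \<Rightarrow> 'd::banach" and b e
    by (intro integrable_continuous continuous_intros continuous_on_weight[OF that(2)] continuous_on_shift[OF that(1)] that(2))
  have int3: "(\<lambda>z. bump b (1 - z \<bullet> z) *\<^sub>R h (?s z)) integrable_on supp_box"
    if "C_infinity h" "b > 0" for h :: "'c \<Rightarrow> 'd::banach" and b
    by (intro integrable_continuous continuous_intros continuous_on_weight[OF that(2)] continuous_on_shift[OF that(1)] that(2))
  have Ce: "C_infinity (\<lambda>z::'a. z \<bullet> e)" for e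
    by (intro C_infinity_bounded_linear bounded_linear_inner_left)
  have De: "D e (\<lambda>z::'a. z \<bullet> e) z = e \<bullet> e" for e z
    by (rule D_eqI) (rule bounded_linear_imp_has_derivative[OF bounded_linear_inner_left])
  \<comment> \<open>\<open>integral_by_parts\<close> is applied to \<open>z \<bullet> e\<close>
    times g. The derivative of the factor \<open>z \<bullet> e\<close> contributes one copy of the
    average for each e, which adds up to the dimension.\<close>
  have by_parts: "integral supp_box (\<lambda>z. bump (a + 1) (1 - z \<bullet> z) *\<^sub>R (z \<bullet> e) *\<^sub>R snd q *\<^sub>R D (\<iota> e) g (?s z)) + wavg \<iota> (a + 1) g q
      = (2 * (a + 1)) *\<^sub>R integral supp_box (\<lambda>z. bump a (1 - z \<bullet> z) *\<^sub>R (z \<bullet> e) *\<^sub>R (z \<bullet> e) *\<^sub>R g (?s z))"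
    if "e \<in> Basis" for e
  proof -
    have "(2 * (a + 1)) *\<^sub>R integral supp_box (\<lambda>z. bump a (1 - z \<bullet> z) *\<^sub>R (z \<bullet> e) *\<^sub>R (z \<bullet> e) *\<^sub>R g (?s z))
      = integral supp_box (\<lambda>z. bump (a + 1) (1 - z \<bullet> z) *\<^sub>R D e (\<lambda>z. (z \<bullet> e) *\<^sub>R g (?s z)) z)"
      by (rule integral_by_parts[symmetric, OF _ a]) (intro C_infinity_scaleR Ce C_infinity_shift_at g)
    also have "D e (\<lambda>z. (z \<bullet> e) *\<^sub>R g (?s z)) = (\<lambda>z. (z \<bullet> e) *\<^sub>R snd q *\<^sub>R D (\<iota> e) g (?s z) + g (?s z))"
      by (simp add: D_C_infinity_scaleR[OF Ce C_infinity_shift_at[OF g]] De D_shift_at[OF g] that)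
    also have "integral supp_box (\<lambda>z. bump (a + 1) (1 - z \<bullet> z) *\<^sub>R ((z \<bullet> e) *\<^sub>R snd q *\<^sub>R D (\<iota> e) g (?s z) + g (?s z)))
      = integral supp_box (\<lambda>z. bump (a + 1) (1 - z \<bullet> z) *\<^sub>R (z \<bullet> e) *\<^sub>R snd q *\<^sub>R D (\<iota> e) g (?s z)) + wavg \<iota> (a + 1) g q"
      unfolding wavg_def scaleR_add_right
      by (rule integral_add[OF int2[OF C_infinity_scaleR_const[OF C_infinity_D[OF g]] a1] int3[OF g a1]])
    finally show ?thesis ..
  qed
  have "snd q *\<^sub>R D (0, 1) (wavg \<iota> (a + 1) g) q
      = snd q *\<^sub>R integral supp_box (\<lambda>z. \<Sum>e\<in>Basis. bump (a + 1) (1 - z \<bullet> z) *\<^sub>R (z \<bullet> e) *\<^sub>R D (\<iota> e) g (?s z))"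
    unfolding D_wavg[OF g a1]
  proof (intro arg_cong[of _ _ "\<lambda>F. _ *\<^sub>R integral supp_box F"] ext)
    fix z
    show "bump (a + 1) (1 - z \<bullet> z) *\<^sub>R D (0 + 1 *\<^sub>R \<iota> z) g (?s z)
      = (\<Sum>e\<in>Basis. bump (a + 1) (1 - z \<bullet> z) *\<^sub>R (z \<bullet> e) *\<^sub>R D (\<iota> e) g (?s z))"
      using D_embed_sum[OF g, of z "?s z"] by (simp add: scaleR_sum_right)
  qed
  also have "\<dots> = (\<Sum>e\<in>Basis. integral supp_box (\<lambda>z. bump (a + 1) (1 - z \<bullet> z) *\<^sub>R (z \<bullet> e) *\<^sub>R snd q *\<^sub>R D (\<iota> e) g (?s z)))"
    by (simp only: integral_sum[OF finite_Basis int2[OF C_infinity_D[OF g] a1]] scaleR_sum_right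
        scaleR_left_commute[of _ "snd q"] integral_cmul)
  also have "\<dots> = (\<Sum>e\<in>Basis. (2 * (a + 1)) *\<^sub>R integral supp_box (\<lambda>z. bump a (1 - z \<bullet> z) *\<^sub>R (z \<bullet> e) *\<^sub>R (z \<bullet> e) *\<^sub>R g (?s z)) - wavg \<iota> (a + 1) g q)"
    by (rule sum.cong[OF refl], rule eq_diff_eq[THEN iffD2, OF by_parts])
  also have "\<dots> = (2 * (a + 1)) *\<^sub>R (\<Sum>e\<in>Basis. integral supp_box (\<lambda>z. bump a (1 - z \<bullet> z) *\<^sub>R (z \<bullet> e) *\<^sub>R (z \<bullet> e) *\<^sub>R g (?s z)))
      - real DIM('a) *\<^sub>R wavg \<iota> (a + 1) g q"
    by (simp add: sum_subtractf scaleR_sum_right sum_constant_scaleR)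
  also have "(\<Sum>e\<in>Basis. integral supp_box (\<lambda>z. bump a (1 - z \<bullet> z) *\<^sub>R (z \<bullet> e) *\<^sub>R (z \<bullet> e) *\<^sub>R g (?s z)))
      = integral supp_box (\<lambda>z. \<Sum>e\<in>Basis. bump a (1 - z \<bullet> z) *\<^sub>R (z \<bullet> e) *\<^sub>R (z \<bullet> e) *\<^sub>R g (?s z))"
    by (rule integral_sum[symmetric, OF finite_Basis int1[OF g a]])
  also have "(\<lambda>z. \<Sum>e\<in>Basis. bump a (1 - z \<bullet> z) *\<^sub>R (z \<bullet> e) *\<^sub>R (z \<bullet> e) *\<^sub>R g (?s z))
      = (\<lambda>z. bump a (1 - z \<bullet> z) *\<^sub>R g (?s z) - bump (a + 1) (1 - z \<bullet> z) *\<^sub>R g (?s z))"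
  proof
    fix z :: 'a
    have "(\<Sum>e\<in>Basis. bump a (1 - z \<bullet> z) *\<^sub>R (z \<bullet> e) *\<^sub>R (z \<bullet> e) *\<^sub>R g (?s z))
        = (bump a (1 - z \<bullet> z) * (\<Sum>e\<in>Basis. (z \<bullet> e) * (z \<bullet> e))) *\<^sub>R g (?s z)"
      by (simp add: scaleR_sum_left sum_distrib_left)
    also have "(\<Sum>e\<in>Basis. (z \<bullet> e) * (z \<bullet> e)) = z \<bullet> z"
      by (rule euclidean_inner[symmetric])
    finally show "(\<Sum>e\<in>Basis. bump a (1 - z \<bullet> z) *\<^sub>R (z \<bullet> e) *\<^sub>R (z \<bullet> e) *\<^sub>R g (?s z))
        = bump a (1 - z \<bullet> z) *\<^sub>R g (?s z) - bump (a + 1) (1 - z \<bullet> z) *\<^sub>R g (?s z)"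
      unfolding bump_add_one scaleR_diff_left[symmetric] by (simp only: algebra_simps mult_1_left)
  qed
  also have "integral supp_box \<dots> = wavg \<iota> a g q - wavg \<iota> (a + 1) g q"
    unfolding wavg_def by (rule integral_diff[OF int3[OF g a] int3[OF g a1]])
  finally show ?thesis
    by (simp add: algebra_simps)
qed

text \<open>\<open>D_time_wavg\<close> expresses Q_T by the average \<open>S\<close> of exponent a +
  1; differentiating again, \<open>D_time_wavg_radial\<close> returns to exponent a, where the
  Laplacian of Q appears, plus a multiple of \<open>S\<close>, that is, of Q_T / T.\<close>

lemma EPD_wavg:
  fixes f :: "'c \<Rightarrow> 'd::banach"
  assumes f: "C_infinity f" and a: "a > 0"
  shows "EPD (real DIM('a) + 1 + 2 * a) \<iota> (wavg \<iota> a f)"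
  unfolding EPD_def
proof
  fix q :: "'c \<times> real"
  have a1: "a + 1 > 0" using a by simp
  define S where "S = wavg \<iota> (a + 1) (lap \<iota> f)"
  define c where "c = 1 / (2 * (a + 1))"
  have S: "C_infinity S"
    unfolding S_def by (intro C_infinity_wavg C_infinity_lap f a1)
  have D1: "D (0, 1) (wavg \<iota> a f) = (\<lambda>q. c *\<^sub>R snd q *\<^sub>R S q)"
    unfolding S_def c_def by (rule D_time_wavg[OF f a])
  have "D (0, 1) (D (0, 1) (wavg \<iota> a f)) q = c *\<^sub>R (snd q *\<^sub>R D (0, 1) S q + S q)"
    unfolding D1 by (subst D_C_infinity_scaleR_const) (simp_all add: D_snd_scaleR S C_infinity_intros)
  also have "\<dots> = c *\<^sub>R ((2 * (a + 1)) *\<^sub>R wavg \<iota> a (lap \<iota> f) q - (real DIM('a) + 2 * (a + 1)) *\<^sub>R S q + S q)"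
    unfolding S_def by (simp only: D_time_wavg_radial[OF C_infinity_lap[OF f] a])
  also have "\<dots> = (c * (2 * (a + 1))) *\<^sub>R lap (\<lambda>e. (\<iota> e, 0)) (wavg \<iota> a f) q - (real DIM('a) + 1 + 2 * a) *\<^sub>R c *\<^sub>R S q"
  proof -
    have "(real DIM('a) + 2 * (a + 1)) *\<^sub>R S q = (real DIM('a) + 1 + 2 * a) *\<^sub>R S q + S q"
      by (simp add: algebra_simps scaleR_2)
    moreover have "c *\<^sub>R (d *\<^sub>R A - (k' *\<^sub>R B + B) + B) = (c * d) *\<^sub>R A - k' *\<^sub>R c *\<^sub>R B" for d k' and A B :: 'd
      by (simp add: scaleR_diff_right mult.commute)
    ultimately show ?thesis
      unfolding lap_wavg[OF f a] by (simp only:)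
  qed
  also have "c * (2 * (a + 1)) = 1"
    using a by (simp add: c_def)
  finally have D2: "D (0, 1) (D (0, 1) (wavg \<iota> a f)) q
    = lap (\<lambda>e. (\<iota> e, 0)) (wavg \<iota> a f) q - (real DIM('a) + 1 + 2 * a) *\<^sub>R c *\<^sub>R S q" by simp
  show "snd q *\<^sub>R D (0, 1) (D (0, 1) (wavg \<iota> a f)) q + (real DIM('a) + 1 + 2 * a) *\<^sub>R D (0, 1) (wavg \<iota> a f) q =
    snd q *\<^sub>R lap (\<lambda>e. (\<iota> e, 0)) (wavg \<iota> a f) q"
    unfolding D2 by (simp add: D1 scaleR_diff_right scaleR_left_commute[of _ "snd q"])
qed

lemma wavg_at_0:
  assumes "a > 0"
  shows "wavg \<iota> a f (p, 0) = integral supp_box (\<lambda>z. bump a (1 - z \<bullet> z)) *\<^sub>R f p"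
proof -
  have "(\<lambda>z::'a. bump a (1 - z \<bullet> z)) integrable_on supp_box"
    by (intro integrable_continuous continuous_on_weight assms)
  from integral_unique[OF has_integral_scaleR_left[OF integrable_integral[OF this]]] show ?thesis
    by (simp add: wavg_def)
qed

lemma weight_integral_pos:
  assumes "a > 0"
  shows "integral supp_box (\<lambda>z. bump a (1 - z \<bullet> z)) > 0"
proof -
  have "integral supp_box (\<lambda>z. bump a (1 - z \<bullet> z)) \<ge> 0"
    by (intro integral_nonneg integrable_continuous continuous_on_weight assms bump_nonneg)
  moreover have "integral supp_box (\<lambda>z. bump a (1 - z \<bullet> z)) \<noteq> 0"
  proof
    assume *: "integral supp_box (\<lambda>z. bump a (1 - z \<bullet> z)) = 0"
    have "(0::'a) \<in> supp_box" "box (- corner) (corner :: 'a) \<noteq> {}"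
      by (auto simp: corner_def mem_box box_ne_empty)
    then have "bump a (1 - (0::'a) \<bullet> 0) = 0"
      using integral_cbox_eq_0_iff[of "- corner" "corner :: 'a" "\<lambda>z. bump a (1 - z \<bullet> z)"]
        continuous_on_weight[OF assms] bump_nonneg * by blast
    then show False by (simp add: bump_def)
  qed
  ultimately show ?thesis by linarith
qed

proposition smooth_wave_solution_exists:
  fixes f :: "'c \<Rightarrow> 'b::banach"
  assumes f: "C_infinity f"
  shows "\<exists>W :: 'c \<times> real \<Rightarrow> 'b. C_infinity W \<and> (\<forall>q. D (0, 1) (D (0, 1) W) q = lap (\<lambda>e. (\<iota> e, 0)) W q) \<and>
    (\<forall>p. W (p, 0) = f p) \<and> (\<forall>p. D (0, 1) W (p, 0) = 0)"
proof -
  \<comment> \<open>With this exponent kappa = n + 1 + 2 a equals 2 n + 2, an even integer whether n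
    is even or odd.\<close>
  define a where "a = (real DIM('a) + 1) / 2"
  have a: "a > 0" by (simp add: a_def add_pos_nonneg)
  define c where "c = integral supp_box (\<lambda>z. bump a (1 - z \<bullet> z))"
  have c: "c > 0" unfolding c_def by (rule weight_integral_pos[OF a])
  have wavg: "wavg \<iota> a f (p, 0) = c *\<^sub>R f p" for p
    unfolding c_def by (rule wavg_at_0[OF a])
  have "EPD (2 * real DIM('a) + 2) \<iota> (wavg \<iota> a f)"
    using EPD_wavg[OF f a] by (simp add: a_def add_divide_distrib algebra_simps)
  from wave_from_EPD[OF C_infinity_wavg[OF f a] this] obtain W :: "'c \<times> real \<Rightarrow> 'b" and C where W: "C_infinity W" "C > 0"
      "\<And>q. D (0, 1) (D (0, 1) W) q = lap (\<lambda>e. (\<iota> e, 0)) W q"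
      "\<And>p. W (p, 0) = C *\<^sub>R wavg \<iota> a f (p, 0)" "\<And>p. D (0, 1) W (p, 0) = 0"
    by blast
  \<comment> \<open>Divides out the mass \<open>c\<close> of the weight and the factor
    \<open>C\<close> collected during the descent.\<close>
  define W' where "W' = (\<lambda>q. (1 / (C * c)) *\<^sub>R W q)"
  have D1: "D v W' = (\<lambda>q. (1 / (C * c)) *\<^sub>R D v W q)" for v
    unfolding W'_def by (rule D_C_infinity_scaleR_const[OF W(1)])
  have D2: "D u (D v W') = (\<lambda>q. (1 / (C * c)) *\<^sub>R D u (D v W) q)" for u v
    unfolding D1 by (rule D_C_infinity_scaleR_const[OF C_infinity_D[OF W(1)]])
  show ?thesis
  proof (intro exI[of _ W'] conjI allI)
    show "C_infinity W'" unfolding W'_def by (intro C_infinity_scaleR_const W)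
    show "D (0, 1) (D (0, 1) W') q = lap (\<lambda>e. (\<iota> e, 0)) W' q" for q
      by (simp add: lap_def D2 W(3) scaleR_sum_right)
    show "W' (p, 0) = f p" for p
      using W(2) c by (simp add: W'_def W(4) wavg)
    show "D (0, 1) W' (p, 0) = 0" for p
      by (simp add: D1 W(5))
  qed
qed

end

section \<open>Oriented integrals\<close>

text \<open>The oriented integral from 0 to \<open>\<tau>\<close> after the substitution r = tau s.
  The domain is fixed, so smoothness in \<open>\<tau>\<close> follows from parameter integrals, and
  negative \<open>\<tau>\<close> gives the right sign.\<close>

definition oint :: "(real \<Rightarrow> 'b::banach) \<Rightarrow> real \<Rightarrow> 'b" where
  "oint B \<tau> = \<tau> *\<^sub>R integral (cbox 0 1) (\<lambda>s. B (\<tau> * s))"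

lemma oint_0 [simp]: "oint B 0 = 0"
  by (simp add: oint_def)

lemma oint_zero [simp]: "oint (\<lambda>_. 0) \<tau> = 0"
  by (simp add: oint_def)

lemma integrable_oint:
  fixes B :: "real \<Rightarrow> 'b::banach"
  assumes "continuous_on UNIV B"
  shows "(\<lambda>s. B (\<tau> * s)) integrable_on cbox 0 1"
  by (intro integrable_continuous continuous_on_compose2[OF assms] continuous_intros) auto

lemma oint_add:
  "continuous_on UNIV B \<Longrightarrow> continuous_on UNIV B' \<Longrightarrow> oint (\<lambda>r. B r + B' r) \<tau> = oint B \<tau> + oint B' \<tau>"
  unfolding oint_def by (subst integral_add) (auto intro: integrable_oint simp: scaleR_add_right simp del: cbox_interval box_real)

lemma oint_scaleR: "oint (\<lambda>r. c *\<^sub>R B r) \<tau> = c *\<^sub>R oint B \<tau>"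
  unfolding oint_def by (simp add: integral_cmul scaleR_left_commute)

lemma oint_sum:
  assumes "finite I" "\<And>i. i \<in> I \<Longrightarrow> continuous_on UNIV (B i)"
  shows "oint (\<lambda>r. \<Sum>i\<in>I. B i r) \<tau> = (\<Sum>i\<in>I. oint (B i) \<tau>)"
  unfolding oint_def using assms by (subst integral_sum) (auto intro: integrable_oint simp: scaleR_sum_right simp del: cbox_interval box_real)

lemma oint_eq_diff:
  fixes A :: "real \<Rightarrow> 'b::banach"
  assumes "\<And>r. (A has_vector_derivative B r) (at r)"
  shows "oint B \<tau> = A \<tau> - A 0"
proof -
  have "((\<lambda>s. A (\<tau> * s)) has_vector_derivative \<tau> *\<^sub>R B (\<tau> * s)) (at s within {0..1})" for s
  proof -
    have "((\<lambda>s. \<tau> * s) has_vector_derivative \<tau>) (at s)"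
      by (auto intro!: derivative_eq_intros)
    from vector_diff_chain_at[OF this assms] show ?thesis
      by (simp add: o_def has_vector_derivative_at_within)
  qed
  then have "((\<lambda>s. \<tau> *\<^sub>R B (\<tau> * s)) has_integral A (\<tau> * 1) - A (\<tau> * 0)) {0..1}"
    by (intro fundamental_theorem_of_calculus) auto
  from integral_unique[OF this] show ?thesis
    by (simp add: oint_def integral_cmul)
qed

section \<open>Integrals with variable upper limit\<close>

text \<open>Common form of the Bessel integral and of the Duhamel integral: the last coordinate of q
  is the upper limit and may also enter the integrand.\<close>

definition volterra :: "(('c::euclidean_space \<times> real) \<times> real \<Rightarrow> 'b::banach) \<Rightarrow> 'c \<times> real \<Rightarrow> 'b" where
  "volterra H = (\<lambda>q. oint (\<lambda>r. H (q, r)) (snd q))"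

lemma volterra_has_derivative_aux:
  fixes H :: "('c::euclidean_space \<times> real) \<times> real \<Rightarrow> 'b::banach"
  assumes H: "C_infinity H"
  shows "C_infinity (\<lambda>q. integral (cbox 0 1) (\<lambda>s. H (q, snd q * s)))" (is "C_infinity ?P")
    and "D (v, \<sigma>) (\<lambda>q. integral (cbox 0 1) (\<lambda>s. H (q, snd q * s))) q
      = integral (cbox 0 1) (\<lambda>s. D ((v, \<sigma>), \<sigma> * s) H (q, snd q * s))"
proof -
  define G where "G = (\<lambda>x::('c \<times> real) \<times> real. H (fst x, snd (fst x) * snd x))"
  have G: "C_infinity G"
    unfolding G_def by (intro C_infinity_compose[OF H] C_infinity_intros)
  have DG: "D (d, 0) G (q, s) = D (d, snd d * s) H (q, snd q * s)" for d s
  proof -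
    have "(G has_derivative (\<lambda>d. D (fst d, snd q * snd d + snd (fst d) * s) H (q, snd q * s))) (at (q, s))"
      unfolding G_def
      by (rule has_derivative_compose[where g = H and f = "\<lambda>x. (fst x, snd (fst x) * snd x)" and x = "(q, s)", simplified,
            OF _ C_infinity_has_derivative[OF H]])
        (auto intro!: derivative_eq_intros)
    from D_eqI[OF this] show ?thesis by simp
  qed
  show "C_infinity ?P"
    using C_class_param_integral[OF C_infinity_imp_C_class[OF G], of 0 1 "\<lambda>_. 1"]
    by (simp add: C_infinity_def G_def)
  show "D (v, \<sigma>) ?P q = integral (cbox 0 1) (\<lambda>s. D ((v, \<sigma>), \<sigma> * s) H (q, snd q * s))"
    using D_param_integral[OF C_infinity_imp_C_class[OF G], of 0 1 "\<lambda>_. 1" "(v, \<sigma>)" q]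
    by (simp add: DG) (simp add: G_def)
qed

lemma C_infinity_volterra:
  fixes H :: "('c::euclidean_space \<times> real) \<times> real \<Rightarrow> 'b::banach"
  assumes H: "C_infinity H"
  shows "C_infinity (volterra H)"
  unfolding volterra_def oint_def
  by (intro C_infinity_scaleR C_infinity_snd C_infinity_id volterra_has_derivative_aux H)

text \<open>Leibniz rule with moving endpoint. Differentiating tau times the integral over [0, 1]
  also hits the rescaled variable tau s; the resulting terms form the s-derivative of s H(q, tau s),
  whose integral is the boundary value at r = tau.\<close>

lemma D_volterra:
  fixes H :: "('c::euclidean_space \<times> real) \<times> real \<Rightarrow> 'b::banach"
  assumes H: "C_infinity H"
  shows "D (v, \<sigma>) (volterra H) q = \<sigma> *\<^sub>R H (q, snd q) + volterra (D ((v, \<sigma>), 0) H) q"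
proof -
  let ?\<tau> = "snd q"
  define P where "P = (\<lambda>q. integral (cbox 0 1) (\<lambda>s. H (q, snd q * s)))"
  note aux = volterra_has_derivative_aux[OF H, folded P_def]
  have VP: "volterra H = (\<lambda>q. snd q *\<^sub>R P q)"
    by (simp add: volterra_def oint_def P_def)
  \<comment> \<open>Separates the dependence on the parameter q from that through the rescaled
    variable tau s.\<close>
  have split: "D ((v, \<sigma>), \<sigma> * s) H (q, ?\<tau> * s) = D ((v, \<sigma>), 0) H (q, ?\<tau> * s) + \<sigma> *\<^sub>R s *\<^sub>R D (0, 1) H (q, ?\<tau> * s)" for s
  proof -
    have "((v, \<sigma>), \<sigma> * s) = ((v, \<sigma>), 0) + \<sigma> *\<^sub>R s *\<^sub>R (0, 1)"
      by (simp add: zero_prod_def)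
    then show ?thesis
      by (simp only: D_add_dir[OF C_infinity_differentiable[OF H]] D_scaleR[OF C_infinity_differentiable[OF H]])
  qed
  have cont: "continuous_on X (\<lambda>s. H (q, ?\<tau> * s))" "continuous_on X (\<lambda>s. D d H (q, ?\<tau> * s))" for X d
    by (rule C_infinity_continuous_on[OF H] C_infinity_continuous_on[OF C_infinity_D[OF H]],
        intro continuous_intros)+
  have "((\<lambda>s. ?\<tau> *\<^sub>R s *\<^sub>R D (0, 1) H (q, ?\<tau> * s) + H (q, ?\<tau> * s)) has_integral 1 *\<^sub>R H (q, ?\<tau> * 1) - 0 *\<^sub>R H (q, ?\<tau> * 0)) {0..1}"
  proof (rule fundamental_theorem_of_calculus)
    fix s :: real
    have "((\<lambda>s. (q, ?\<tau> * s)) has_vector_derivative ?\<tau> *\<^sub>R (0, 1)) (at s)"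
      by (auto simp: has_vector_derivative_def intro!: derivative_eq_intros)
    from C_infinity_has_vector_derivative[OF H this]
    have "((\<lambda>s. s *\<^sub>R H (q, ?\<tau> * s)) has_vector_derivative (s *\<^sub>R ?\<tau> *\<^sub>R D (0, 1) H (q, ?\<tau> * s) + 1 *\<^sub>R H (q, ?\<tau> * s))) (at s)"
      by (intro has_vector_derivative_scaleR) (auto simp only: D_scaleR[OF C_infinity_differentiable[OF H]] intro!: derivative_eq_intros)
    then show "((\<lambda>s. s *\<^sub>R H (q, ?\<tau> * s)) has_vector_derivative ?\<tau> *\<^sub>R s *\<^sub>R D (0, 1) H (q, ?\<tau> * s) + H (q, ?\<tau> * s)) (at s within {0..1})"
      by (simp add: has_vector_derivative_at_within mult.commute)
  qed simp
  then have "integral (cbox 0 1) (\<lambda>s. ?\<tau> *\<^sub>R s *\<^sub>R D (0, 1) H (q, ?\<tau> * s) + H (q, ?\<tau> * s)) = H (q, ?\<tau>)"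
    by (simp add: integral_unique)
  moreover have "integral (cbox 0 1) (\<lambda>s. ?\<tau> *\<^sub>R s *\<^sub>R D (0, 1) H (q, ?\<tau> * s) + H (q, ?\<tau> * s))
    = integral (cbox 0 1) (\<lambda>s. ?\<tau> *\<^sub>R s *\<^sub>R D (0, 1) H (q, ?\<tau> * s)) + P q"
    unfolding P_def
    by (intro integral_add integrable_continuous continuous_on_scaleR continuous_on_const continuous_on_id cont)
  ultimately have by_parts: "?\<tau> *\<^sub>R integral (cbox 0 1) (\<lambda>s. s *\<^sub>R D (0, 1) H (q, ?\<tau> * s)) + P q = H (q, ?\<tau>)"
    by (simp only: integral_cmul)
  have "D (v, \<sigma>) (volterra H) q = ?\<tau> *\<^sub>R D (v, \<sigma>) P q + \<sigma> *\<^sub>R P q"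
    unfolding VP by (simp add: D_snd_scaleR aux)
  also have "D (v, \<sigma>) P q = integral (cbox 0 1) (\<lambda>s. D ((v, \<sigma>), 0) H (q, ?\<tau> * s)) + integral (cbox 0 1) (\<lambda>s. \<sigma> *\<^sub>R s *\<^sub>R D (0, 1) H (q, ?\<tau> * s))"
    unfolding aux split
    by (intro integral_add integrable_continuous continuous_on_scaleR continuous_on_const continuous_on_id cont)
  also have "?\<tau> *\<^sub>R \<dots> = volterra (D ((v, \<sigma>), 0) H) q + \<sigma> *\<^sub>R ?\<tau> *\<^sub>R integral (cbox 0 1) (\<lambda>s. s *\<^sub>R D (0, 1) H (q, ?\<tau> * s))"
    by (simp only: integral_cmul scaleR_add_right scaleR_left_commute[of ?\<tau> \<sigma>] volterra_def oint_def)
  finally show ?thesis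
    by (simp add: algebra_simps flip: by_parts)
qed

lemma oint_has_vector_derivative:
  fixes B :: "real \<Rightarrow> 'b::banach"
  assumes B: "C_infinity B"
  shows "(oint B has_vector_derivative B \<tau>) (at \<tau>)"
proof -
  define H where "H = (\<lambda>x::(real \<times> real) \<times> real. B (snd x))"
  have H: "C_infinity H"
    unfolding H_def by (intro C_infinity_snd C_infinity_compose[OF B] C_infinity_id)
  have "D d H = (\<lambda>x. D (snd d) B (snd x))" for d
    unfolding H_def
    by (rule D_C_infinity_compose_affine[OF B bounded_linear_imp_has_derivative[OF bounded_linear_snd]])
  moreover have "D 0 B r = 0" for r
    using D_scaleR[OF C_infinity_differentiable[OF B], of 0 0] by simp
  ultimately have "D (0, 1) (volterra H) (0, \<tau>) = B \<tau>"
    using D_volterra[OF H, of 0 1 "(0, \<tau>)"] by (simp add: volterra_def) (simp add: H_def)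
  moreover have "((\<lambda>s. volterra H (0, s)) has_vector_derivative D (0, 1) (volterra H) (0, \<tau>)) (at \<tau>)"
    by (intro C_infinity_has_vector_derivative C_infinity_volterra H) (auto intro!: derivative_eq_intros)
  ultimately show ?thesis
    by (simp add: volterra_def H_def)
qed

text \<open>\<open>oint\<close> supplies an antiderivative on the whole line, and the fundamental
  theorem for oriented interval integrals then covers both orders of the limits at once.\<close>

lemma interval_integral_eq_oint:
  fixes B :: "real \<Rightarrow> 'b::euclidean_space"
  assumes B: "C_infinity B"
  shows "(LBINT x=ereal a..ereal b. B x) = oint (\<lambda>s. B (a + s)) (b - a)"
proof -
  have Ba: "C_infinity (\<lambda>s. B (a + s))"
    by (intro C_infinity_compose[OF B] C_infinity_intros)
  have "((\<lambda>x. oint (\<lambda>s. B (a + s)) (x - a)) has_vector_derivative B x) (at x)" for x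
  proof -
    have "((\<lambda>x. x - a) has_vector_derivative 1) (at x)"
      by (auto intro!: derivative_eq_intros)
    from vector_diff_chain_at[OF this oint_has_vector_derivative[OF Ba]] show ?thesis
      by (simp add: o_def)
  qed
  then have "(LBINT x=a..b. B x) = oint (\<lambda>s. B (a + s)) (b - a) - oint (\<lambda>s. B (a + s)) (a - a)"
    by (intro interval_integral_FTC_finite C_infinity_continuous_on[OF B])
      (auto intro: has_vector_derivative_at_within)
  then show ?thesis by simp
qed

section \<open>Bessel kernels and the Klein--Gordon equation\<close>

text \<open>For c y > 0 this is (c y)^(-j/2) I_j(2 sqrt(c y)), with I_j the modified Bessel
  function. As a power series in y it is smooth for all real y and both signs of c, and
  differentiation in y only shifts j.\<close>

definition bker :: "real \<Rightarrow> nat \<Rightarrow> real \<Rightarrow> real" where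
  "bker c j y = (\<Sum>k. c ^ k / (fact k * fact (k + j)) * y ^ k)"

lemma bker_summable: "summable (\<lambda>k. c ^ k / (fact k * fact (k + j)) * y ^ k :: real)"
proof (rule summable_comparison_test'[OF summable_exp[of "\<bar>c * y\<bar>"], of 0])
  fix k :: nat
  have "(1::real) \<le> fact (k + j)" by (rule fact_ge_1)
  then have "\<bar>c * y\<bar> ^ k / fact k / fact (k + j) \<le> \<bar>c * y\<bar> ^ k / fact k"
    using mult_left_mono[of 1 "fact (k + j)" "\<bar>c * y\<bar> ^ k / fact k"] by (simp add: pos_divide_le_eq)
  then show "norm (c ^ k / (fact k * fact (k + j)) * y ^ k) \<le> inverse (fact k) * \<bar>c * y\<bar> ^ k"
    by (simp add: abs_mult power_abs power_mult_distrib field_simps)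
qed

lemma bker_has_derivative: "(bker c j has_real_derivative c * bker c (Suc j) y) (at y)"
proof -
  have "diffs (\<lambda>k. c ^ k / (fact k * fact (k + j))) = (\<lambda>k. c * (c ^ k / (fact k * fact (k + Suc j))))"
    by (auto simp: diffs_def fun_eq_iff field_simps simp del: of_nat_Suc)
  then have "(\<Sum>k. diffs (\<lambda>k. c ^ k / (fact k * fact (k + j))) k * y ^ k) = c * bker c (Suc j) y"
    using suminf_mult[OF bker_summable[of c "Suc j" y], of c] by (simp add: bker_def mult.assoc)
  then show ?thesis
    using termdiffs_strong_converges_everywhere[of "\<lambda>k. c ^ k / (fact k * fact (k + j))" y] bker_summable[of c j]
    by (simp add: bker_def[abs_def])
qed

lemma C_infinity_bker: "C_infinity (bker c j)"
  unfolding C_infinity_def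
proof
  fix k
  show "C_class k (bker c j)"
  proof (induction k arbitrary: j)
    case 0
    have "isCont (bker c j) y" for y
      using bker_has_derivative by (rule DERIV_isCont)
    then show ?case by (simp add: continuous_on_eq_continuous_at)
  next
    case (Suc k)
    show ?case
    proof (rule C_class_SucI)
      show "(bker c j has_derivative (*) (c * bker c (Suc j) y)) (at y)" for y
        using bker_has_derivative unfolding has_field_derivative_def .
      show "C_class k (\<lambda>p. c * bker c (Suc j) p * v)" for v
        using C_class_bounded_linear_compose[OF bounded_linear_mult_right[of "c * v"] Suc.IH[of "Suc j"]]
        by (simp add: mult_ac)
    qed
  qed
qed

lemma bker_at_0: "bker c 0 0 = 1" "bker c (Suc 0) 0 = 1"
  unfolding bker_def by (subst suminf_finite[of "{0}"]; simp)+

text \<open>For F = \<open>bker c 0\<close> this is the Bessel equation y F'' + F' = c F with one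
  factor c removed, because F' = c \<open>bker c 1\<close> and F'' = c^2
  \<open>bker c 2\<close>.\<close>

lemma bker_recurrence: "bker c (Suc 0) y + y * (c * bker c (Suc (Suc 0)) y) = bker c 0 y"
proof -
  define b where "b = (\<lambda>k. c ^ k / (fact k * fact (k + 0)) * y ^ k - c ^ k / (fact k * fact (k + Suc 0)) * y ^ k)"
  have b: "summable b" "suminf b = bker c 0 y - bker c (Suc 0) y"
    unfolding b_def bker_def
    by (intro summable_diff bker_summable, intro suminf_diff[symmetric] bker_summable)
  have "b (Suc k) = y * c * (c ^ k / (fact k * fact (k + Suc (Suc 0))) * y ^ k)" for k
    unfolding b_def by (simp add: divide_simps) (simp add: algebra_simps)
  then have "(\<Sum>k. b (Suc k)) = y * c * bker c (Suc (Suc 0)) y"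
    using suminf_mult[OF bker_summable[of c "Suc (Suc 0)" y], of "y * c"] by (simp only: bker_def)
  moreover have "(\<Sum>k. b (Suc k)) = suminf b - b 0"
    by (rule suminf_split_head[OF b(1)])
  moreover have "b 0 = 0" by (simp add: b_def)
  ultimately show ?thesis using b(2) by simp
qed

lemma bessel_term: "y \<ge> 0 \<Longrightarrow> (m * sqrt y / 2) ^ (2 * k) = (m\<^sup>2 / 4) ^ k * y ^ k"
  by (simp add: power_mult power_mult_distrib power_divide)

lemma bessel_J0_eq_bker: "y \<ge> 0 \<Longrightarrow> bessel_J0 (m * sqrt y) = bker (- (m\<^sup>2 / 4)) 0 y"
  unfolding bessel_J0_def bker_def bessel_term power_minus[of "m\<^sup>2 / 4"]
  by (simp add: power2_eq_square[of "fact _"] mult.assoc)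

lemma bessel_I0_eq_bker: "y \<ge> 0 \<Longrightarrow> bessel_I0 (m * sqrt y) = bker (m\<^sup>2 / 4) 0 y"
  unfolding bessel_I0_def bker_def bessel_term
  by (simp add: power2_eq_square[of "fact _"])

lemma C_infinity_bker_compose: "C_infinity g \<Longrightarrow> C_infinity (\<lambda>x. bker c j (g x))"
  by (rule C_infinity_compose[OF C_infinity_bker])

lemma bker_diff_squares_has_derivative:
  "((\<lambda>x::('c::euclidean_space \<times> real) \<times> real. bker c j ((snd (fst x))\<^sup>2 - (snd x)\<^sup>2)) has_derivative
    (\<lambda>d. c * bker c (Suc j) ((snd (fst x))\<^sup>2 - (snd x)\<^sup>2) * (2 * snd (fst x) * snd (fst d) - 2 * snd x * snd d))) (at x)"
proof -
  have "((\<lambda>x::('c \<times> real) \<times> real. (snd (fst x))\<^sup>2 - (snd x)\<^sup>2) has_derivative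
      (\<lambda>d. 2 * snd (fst x) * snd (fst d) - 2 * snd x * snd d)) (at x)"
    by (auto intro!: derivative_eq_intros simp: mult_ac)
  from has_derivative_compose[OF this, of "bker c j"] bker_has_derivative show ?thesis
    unfolding has_field_derivative_def by blast
qed

lemma C_infinity_bker_diff_squares:
  "C_infinity (\<lambda>x::('c::euclidean_space \<times> real) \<times> real. bker c j ((snd (fst x))\<^sup>2 - (snd x)\<^sup>2))"
  unfolding power2_eq_square by (intro C_infinity_bker_compose C_infinity_intros)

lemma C_infinity_fst_fst_snd:
  fixes g :: "'c::euclidean_space \<times> real \<Rightarrow> 'b::real_normed_vector"
  assumes "C_infinity g"
  shows "C_infinity (\<lambda>x::('c \<times> real) \<times> real. g (fst (fst x), snd x))"
  by (intro C_infinity_compose[OF assms] C_infinity_intros)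

lemma D_fst_fst_snd:
  fixes g :: "'c::euclidean_space \<times> real \<Rightarrow> 'b::real_normed_vector"
  assumes "C_infinity g"
  shows "D d (\<lambda>x::('c \<times> real) \<times> real. g (fst (fst x), snd x)) = (\<lambda>x. D (fst (fst d), snd d) g (fst (fst x), snd x))"
  by (rule D_C_infinity_compose_affine[OF assms]) (auto intro!: derivative_eq_intros)

definition kgint :: "real \<Rightarrow> ('c::euclidean_space \<times> real \<Rightarrow> 'b::banach) \<Rightarrow> 'c \<times> real \<Rightarrow> 'b" where
  "kgint c g = volterra (\<lambda>x. bker c 0 ((snd (fst x))\<^sup>2 - (snd x)\<^sup>2) *\<^sub>R g (fst (fst x), snd x))"

lemma C_infinity_kgint: "C_infinity g \<Longrightarrow> C_infinity (kgint c g)"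
  unfolding kgint_def by (intro C_infinity_volterra C_infinity_scaleR C_infinity_bker_diff_squares C_infinity_fst_fst_snd)

lemma kgint_eq: "kgint c g (p, \<tau>) = oint (\<lambda>r. bker c 0 (\<tau>\<^sup>2 - r\<^sup>2) *\<^sub>R g (p, r)) \<tau>"
  by (simp add: kgint_def volterra_def)

lemma D_kgint_space:
  fixes g :: "'c::euclidean_space \<times> real \<Rightarrow> 'b::banach"
  assumes g: "C_infinity g"
  shows "D (u, 0) (kgint c g) = kgint c (D (u, 0) g)"
proof
  fix q
  have "D ((u, 0), 0) (\<lambda>x. bker c 0 ((snd (fst x))\<^sup>2 - (snd x)\<^sup>2) *\<^sub>R g (fst (fst x), snd x))
      = (\<lambda>x. bker c 0 ((snd (fst x))\<^sup>2 - (snd x)\<^sup>2) *\<^sub>R D (u, 0) g (fst (fst x), snd x))"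
    by (simp add: D_C_infinity_scaleR[OF C_infinity_bker_diff_squares C_infinity_fst_fst_snd[OF g]]
        D_eqI[OF bker_diff_squares_has_derivative] D_fst_fst_snd[OF g])
  then show "D (u, 0) (kgint c g) q = kgint c (D (u, 0) g) q"
    unfolding kgint_def
    by (simp add: D_volterra[OF C_infinity_scaleR[OF C_infinity_bker_diff_squares C_infinity_fst_fst_snd[OF g]]])
qed

lemma D_0: "C_infinity g \<Longrightarrow> D 0 g p = 0"
  using D_scaleR[OF C_infinity_differentiable, of g 0 0] by simp

lemma D_kgint_time:
  fixes g :: "'c::euclidean_space \<times> real \<Rightarrow> 'b::banach"
  assumes g: "C_infinity g"
  shows "D (0, 1) (kgint c g)
    = (\<lambda>q. g q + volterra (\<lambda>x. (2 * c * snd (fst x) * bker c 1 ((snd (fst x))\<^sup>2 - (snd x)\<^sup>2)) *\<^sub>R g (fst (fst x), snd x)) q)"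
proof
  fix q
  have "D ((0, 1), 0) (\<lambda>x. bker c 0 ((snd (fst x))\<^sup>2 - (snd x)\<^sup>2) *\<^sub>R g (fst (fst x), snd x))
      = (\<lambda>x. (2 * c * snd (fst x) * bker c 1 ((snd (fst x))\<^sup>2 - (snd x)\<^sup>2)) *\<^sub>R g (fst (fst x), snd x))"
    by (simp add: D_C_infinity_scaleR[OF C_infinity_bker_diff_squares C_infinity_fst_fst_snd[OF g]]
        D_eqI[OF bker_diff_squares_has_derivative] D_fst_fst_snd[OF g] D_0[OF g, unfolded zero_prod_def] mult_ac)
  then show "D (0, 1) (kgint c g) q
    = g q + volterra (\<lambda>x. (2 * c * snd (fst x) * bker c 1 ((snd (fst x))\<^sup>2 - (snd x)\<^sup>2)) *\<^sub>R g (fst (fst x), snd x)) q"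
    unfolding kgint_def
    by (simp add: D_volterra[OF C_infinity_scaleR[OF C_infinity_bker_diff_squares C_infinity_fst_fst_snd[OF g]]] bker_at_0)
qed

lemma DD_kgint_time:
  fixes g :: "'c::euclidean_space \<times> real \<Rightarrow> 'b::banach"
  assumes g: "C_infinity g"
  shows "D (0, 1) (D (0, 1) (kgint c g)) (p, \<tau>) = D (0, 1) g (p, \<tau>) + (2 * c * \<tau>) *\<^sub>R g (p, \<tau>)
    + oint (\<lambda>r. (2 * c * bker c 1 (\<tau>\<^sup>2 - r\<^sup>2) + 4 * c\<^sup>2 * \<tau>\<^sup>2 * bker c 2 (\<tau>\<^sup>2 - r\<^sup>2)) *\<^sub>R g (p, r)) \<tau>"
proof -
  define a where "a = (\<lambda>x::('c \<times> real) \<times> real. 2 * c * snd (fst x) * bker c 1 ((snd (fst x))\<^sup>2 - (snd x)\<^sup>2))"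
  have a: "C_infinity a"
    unfolding a_def by (intro C_infinity_mult C_infinity_bker_diff_squares C_infinity_intros)
  have Da: "D ((0, 1), 0) a x = 2 * c * bker c 1 ((snd (fst x))\<^sup>2 - (snd x)\<^sup>2)
      + 4 * c\<^sup>2 * (snd (fst x))\<^sup>2 * bker c 2 ((snd (fst x))\<^sup>2 - (snd x)\<^sup>2)" for x
  proof -
    have "(a has_derivative (\<lambda>d. 2 * c * snd (fst x) * (c * bker c (Suc 1) ((snd (fst x))\<^sup>2 - (snd x)\<^sup>2) * (2 * snd (fst x) * snd (fst d) - 2 * snd x * snd d))
        + 2 * c * snd (fst d) * bker c 1 ((snd (fst x))\<^sup>2 - (snd x)\<^sup>2))) (at x)"
      unfolding a_def
      by (intro has_derivative_mult bker_diff_squares_has_derivative) (auto intro!: derivative_eq_intros)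
    from D_eqI[OF this] show ?thesis
      by (simp add: power2_eq_square numeral_2_eq_2)
  qed
  define H where "H = (\<lambda>x. a x *\<^sub>R g (fst (fst x), snd x))"
  have H: "C_infinity H"
    unfolding H_def by (intro C_infinity_scaleR a C_infinity_fst_fst_snd g)
  have DH: "D ((0, 1), 0) H x = D ((0, 1), 0) a x *\<^sub>R g (fst (fst x), snd x)" for x
    unfolding H_def
    by (simp add: D_C_infinity_scaleR[OF a C_infinity_fst_fst_snd[OF g]] D_fst_fst_snd[OF g] D_0[OF g, unfolded zero_prod_def])
  have "D (0, 1) (kgint c g) = (\<lambda>q. g q + volterra H q)"
    unfolding D_kgint_time[OF g] H_def a_def ..
  then have "D (0, 1) (D (0, 1) (kgint c g)) (p, \<tau>) = D (0, 1) g (p, \<tau>) + (H ((p, \<tau>), \<tau>) + volterra (D ((0, 1), 0) H) (p, \<tau>))"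
    by (simp add: D_C_infinity_add[OF g C_infinity_volterra[OF H]] D_volterra[OF H])
  moreover have "H ((p, \<tau>), \<tau>) = (2 * c * \<tau>) *\<^sub>R g (p, \<tau>)"
    using bker_at_0(2) by (simp add: H_def a_def)
  ultimately show ?thesis
    by (simp add: volterra_def DH Da)
qed

lemma continuous_on_kernel_times:
  fixes g :: "'c::euclidean_space \<times> real \<Rightarrow> 'b::banach"
  assumes "C_infinity g" "C_infinity a"
  shows "continuous_on UNIV (\<lambda>r. a r *\<^sub>R g (p, r))"
  by (intro continuous_on_scaleR C_infinity_continuous_on[OF assms(1)] C_class_continuous[OF C_infinity_imp_C_class[OF assms(2)]]
      continuous_intros)

lemma C_infinity_bker_sq: "C_infinity (\<lambda>r. bker c j (\<tau>\<^sup>2 - r\<^sup>2))"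
  unfolding power2_eq_square by (intro C_infinity_bker_compose C_infinity_intros)

lemma lap_kgint:
  fixes g :: "'c::euclidean_space \<times> real \<Rightarrow> 'b::banach"
  assumes g: "C_infinity g"
  shows "lap (\<lambda>e. (\<iota> e, 0)) (kgint c g) (p, \<tau>) = oint (\<lambda>r. bker c 0 (\<tau>\<^sup>2 - r\<^sup>2) *\<^sub>R lap (\<lambda>e. (\<iota> e, 0)) g (p, r)) \<tau>"
  unfolding lap_def
  by (simp only: D_kgint_space[OF g] D_kgint_space[OF C_infinity_D[OF g]] kgint_eq scaleR_sum_right
      oint_sum[OF finite_Basis continuous_on_kernel_times[OF C_infinity_D[OF C_infinity_D[OF g]] C_infinity_bker_sq]])

text \<open>
  Integrating \<open>\<partial>\<^sub>r (K W\<^sub>r + 2 c r K\<^sub>1 W)\<close> over \<open>[0, \<tau>]\<close> trades \<open>W\<^sub>r\<^sub>r = \<Delta>W\<close> under the integral for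
  \<open>W\<close>, and the Bessel equation collects the remaining kernels into \<open>4 c K\<close>.
\<close>
proposition klein_gordon_kgint:
  fixes W :: "'c::euclidean_space \<times> real \<Rightarrow> 'b::banach"
  assumes W: "C_infinity W"
    and wave: "\<And>q. D (0, 1) (D (0, 1) W) q = lap (\<lambda>e. (\<iota> e, 0)) W q"
    and W0: "\<And>p. D (0, 1) W (p, 0) = 0"
  shows "D (0, 1) (D (0, 1) (kgint c W)) q = lap (\<lambda>e. (\<iota> e, 0)) (kgint c W) q + (4 * c) *\<^sub>R kgint c W q"
proof -
  obtain p \<tau> where q: "q = (p, \<tau>)" by (cases q)
  define k where "k = (\<lambda>j r. bker c j (\<tau>\<^sup>2 - r\<^sup>2))"
  have k: "C_infinity (k j)" for j
    unfolding k_def by (rule C_infinity_bker_sq)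
  have dk: "(k j has_real_derivative - 2 * c * r * k (Suc j) r) (at r)" for j r
  proof -
    have "((\<lambda>r. \<tau>\<^sup>2 - r\<^sup>2) has_real_derivative - 2 * r) (at r)"
      by (auto intro!: derivative_eq_intros)
    from DERIV_chain2[OF bker_has_derivative this, of c j] show ?thesis
      by (simp add: k_def mult_ac)
  qed
  have dW: "((\<lambda>r. W (p, r)) has_vector_derivative D (0, 1) W (p, r)) (at r)"
    "((\<lambda>r. D (0, 1) W (p, r)) has_vector_derivative D (0, 1) (D (0, 1) W) (p, r)) (at r)" for r
    by (auto intro!: C_infinity_has_vector_derivative W C_infinity_D derivative_eq_intros)
  define B1 where "B1 = (\<lambda>r. k 0 r *\<^sub>R lap (\<lambda>e. (\<iota> e, 0)) W (p, r))"
  define B2 where "B2 = (\<lambda>r. (2 * c * k 1 r - 4 * c\<^sup>2 * (r * r) * k 2 r) *\<^sub>R W (p, r))"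
  define B3 where "B3 = (\<lambda>r. (2 * c * k 1 r + 4 * c\<^sup>2 * \<tau>\<^sup>2 * k 2 r) *\<^sub>R W (p, r))"
  define A where "A = (\<lambda>r. k 0 r *\<^sub>R D (0, 1) W (p, r) + (2 * c * r * k 1 r) *\<^sub>R W (p, r))"
  have cont: "continuous_on UNIV B1" "continuous_on UNIV B2" "continuous_on UNIV B3"
    unfolding B1_def B2_def B3_def
    by (intro continuous_on_kernel_times W C_infinity_lap C_infinity_diff C_infinity_add C_infinity_mult k
        C_infinity_const C_infinity_id)+
  have "(A has_vector_derivative B1 r + B2 r) (at r)" for r
  proof -
    have "((\<lambda>r. 2 * c * r * k 1 r) has_real_derivative 2 * c * k 1 r - 4 * c\<^sup>2 * (r * r) * k 2 r) (at r)"
      by (rule derivative_eq_intros dk refl)+ (simp add: power2_eq_square numeral_2_eq_2)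
    then have "(A has_vector_derivative (k 0 r *\<^sub>R D (0, 1) (D (0, 1) W) (p, r) + (- 2 * c * r * k (Suc 0) r) *\<^sub>R D (0, 1) W (p, r))
        + ((2 * c * r * k 1 r) *\<^sub>R D (0, 1) W (p, r) + (2 * c * k 1 r - 4 * c\<^sup>2 * (r * r) * k 2 r) *\<^sub>R W (p, r))) (at r)"
      unfolding A_def by (intro has_vector_derivative_add has_vector_derivative_scaleR dk dW)
    then show ?thesis
      by (simp add: B1_def B2_def wave)
  qed
  from oint_eq_diff[OF this, of \<tau>] have "oint B1 \<tau> + oint B2 \<tau> = A \<tau> - A 0"
    by (simp add: oint_add cont)
  also have "\<dots> = D (0, 1) W (p, \<tau>) + (2 * c * \<tau>) *\<^sub>R W (p, \<tau>)"
    by (simp add: A_def k_def bker_at_0 W0)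
  finally have 1: "D (0, 1) W (p, \<tau>) + (2 * c * \<tau>) *\<^sub>R W (p, \<tau>) = oint B1 \<tau> + oint B2 \<tau>" ..
  have "oint B3 \<tau> + oint B2 \<tau> = oint (\<lambda>r. B3 r + B2 r) \<tau>"
    by (simp add: oint_add cont)
  also have "(\<lambda>r. B3 r + B2 r) = (\<lambda>r. (4 * c) *\<^sub>R (k 0 r *\<^sub>R W (p, r)))"
  proof
    fix r
    have k0: "k 0 r = k 1 r + (\<tau>\<^sup>2 - r * r) * (c * k 2 r)"
      using bker_recurrence[of c "\<tau>\<^sup>2 - r\<^sup>2"] by (simp add: k_def numeral_2_eq_2 power2_eq_square)
    have "(2 * c * k 1 r + 4 * c\<^sup>2 * \<tau>\<^sup>2 * k 2 r) + (2 * c * k 1 r - 4 * c\<^sup>2 * (r * r) * k 2 r) = 4 * c * k 0 r"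
      unfolding k0 by (simp add: algebra_simps power2_eq_square)
    then show "B3 r + B2 r = (4 * c) *\<^sub>R (k 0 r *\<^sub>R W (p, r))"
      unfolding B2_def B3_def by (simp flip: scaleR_add_left)
  qed
  also have "oint \<dots> \<tau> = (4 * c) *\<^sub>R kgint c W q"
    unfolding q kgint_eq k_def by (rule oint_scaleR)
  finally have 2: "oint B3 \<tau> + oint B2 \<tau> = (4 * c) *\<^sub>R kgint c W q" .
  have "D (0, 1) (D (0, 1) (kgint c W)) q = (oint B1 \<tau> + oint B2 \<tau>) + oint B3 \<tau>"
    unfolding q DD_kgint_time[OF W] 1 by (simp add: B3_def k_def)
  also have "\<dots> = oint B1 \<tau> + (4 * c) *\<^sub>R kgint c W q"
    by (simp flip: 2)
  also have "oint B1 \<tau> = lap (\<lambda>e. (\<iota> e, 0)) (kgint c W) q"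
    unfolding q lap_kgint[OF W] by (simp add: B1_def k_def)
  finally show ?thesis .
qed

lemma kgint_initial:
  fixes W :: "'c::euclidean_space \<times> real \<Rightarrow> 'b::banach"
  assumes W: "C_infinity W"
  shows "kgint c W (p, 0) = 0" and "D (0, 1) (kgint c W) (p, 0) = W (p, 0)"
  by (simp_all add: kgint_eq D_kgint_time[OF W] volterra_def)

proposition
  fixes v :: "('a::euclidean_space \<times> real) \<times> real \<Rightarrow> 'b::banach" and s :: real
  assumes v: "C_infinity v"
    and v0: "\<And>p. v (p, 0) = 0" and vt0: "\<And>p. D (0, 1) v (p, 0) = f p"
    and kg: "\<And>q. D (0, 1) (D (0, 1) v) q = lap (\<lambda>e. ((e, 0), 0)) v q + \<mu> *\<^sub>R v q"
  defines "u \<equiv> (\<lambda>(x, t). oint (\<lambda>\<beta>. v ((x, s + \<beta>), t - (s + \<beta>))) (t - s))"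
  shows C_infinity_duhamel: "C_infinity u"
    and duhamel: "D (0, 1) (D (0, 1) u) p = lap (\<lambda>e. (e, 0)) u p + \<mu> *\<^sub>R u p + f p"
    and duhamel_initial: "u (x, s) = 0" "D (0, 1) u (x, s) = 0"
proof -
  define h where "h = (\<lambda>y::('a \<times> real) \<times> real. ((fst (fst y), s + snd y), snd (fst y) - snd y))"
  have h: "C_infinity h"
    unfolding h_def by (intro C_infinity_intros)
  have Dh: "D d (\<lambda>y. g (h y)) = (\<lambda>y. D ((fst (fst d), snd d), snd (fst d) - snd d) g (h y))"
    if "C_infinity g" for d and g :: "_ \<Rightarrow> 'b"
    unfolding h_def by (rule D_C_infinity_compose_affine[OF that]) (auto intro!: derivative_eq_intros)
  have gh: "C_infinity (\<lambda>y. g (h y))" if "C_infinity g" for g :: "_ \<Rightarrow> 'b"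
    by (rule C_infinity_compose[OF that h])
  note vD = C_infinity_D[OF v]
  note vDD = C_infinity_D[OF vD]
  define U where "U = volterra (\<lambda>y. v (h y))"
  have U: "C_infinity U"
    unfolding U_def by (rule C_infinity_volterra[OF gh[OF v]])
  have hdiag: "h (q, snd q) = ((fst q, s + snd q), 0)" for q :: "'a \<times> real"
    by (simp add: h_def)
  have DU: "D (w, \<sigma>) U = (\<lambda>q. volterra (\<lambda>y. D ((w, 0), \<sigma>) v (h y)) q)" for w \<sigma>
    unfolding U_def by (simp add: fun_eq_iff D_volterra[OF gh[OF v]] Dh[OF v] hdiag v0)
  have DDtU: "D (0, 1) (D (0, 1) U) q = f (fst q, s + snd q) + volterra (\<lambda>y. D (0, 1) (D (0, 1) v) (h y)) q" for q
    unfolding DU by (simp add: D_volterra[OF gh[OF vD]] Dh[OF vD] hdiag vt0 flip: zero_prod_def)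
  have DDxU: "D (w, 0) (D (w, 0) U) q = volterra (\<lambda>y. D ((w, 0), 0) (D ((w, 0), 0) v) (h y)) q" for q w
    unfolding DU by (simp add: D_volterra[OF gh[OF vD]] Dh[OF vD])
  have cont: "continuous_on UNIV (\<lambda>r. g (h (q, r)))" if "C_infinity g" for q and g :: "_ \<Rightarrow> 'b"
    by (intro C_infinity_continuous_on[OF gh[OF that]] continuous_intros)
  have lapU: "lap (\<lambda>e. (e, 0)) U q = volterra (\<lambda>y. lap (\<lambda>e. ((e, 0), 0)) v (h y)) q" for q
    unfolding lap_def DDxU volterra_def by (simp only: oint_sum[OF finite_Basis cont[OF vDD]])
  have eqU: "D (0, 1) (D (0, 1) U) q = lap (\<lambda>e. (e, 0)) U q + \<mu> *\<^sub>R U q + f (fst q, s + snd q)" for q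
    unfolding DDtU lapU kg fun_cong[OF U_def, of q] volterra_def
    by (simp add: oint_add oint_scaleR cont C_infinity_lap v continuous_on_scaleR)
  have uU: "u = (\<lambda>p. U (fst p, snd p - s))"
    by (auto simp: u_def U_def volterra_def h_def fun_eq_iff diff_diff_eq)
  show "C_infinity u"
    unfolding uU by (intro C_infinity_compose[OF U] C_infinity_intros)
  have shift: "D d (\<lambda>p. g (fst p, snd p - s)) = (\<lambda>p. D d g (fst p, snd p - s))" if "C_infinity g" for d and g :: "'a \<times> real \<Rightarrow> 'b"
    by (rule D_C_infinity_compose_affine[OF that, where L = "\<lambda>d. d"]) (auto intro!: derivative_eq_intros)
  show "D (0, 1) (D (0, 1) u) p = lap (\<lambda>e. (e, 0)) u p + \<mu> *\<^sub>R u p + f p"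
    unfolding lap_def uU shift[OF U] shift[OF C_infinity_D[OF U]] eqU by (simp add: lap_def)
  show "u (x, s) = 0" by (simp add: u_def)
  show "D (0, 1) u (x, s) = 0"
    unfolding uU shift[OF U] DU by (simp add: volterra_def)
qed

lemma dt_eq_D:
  assumes "C_class (Suc k) g"
  shows "dt g = D (0, 1) g"
proof -
  have "((\<lambda>s. g (x, s)) has_vector_derivative D (0, 1) g (x, t)) (at t)" for x t
    by (rule C_class_has_vector_derivative[OF assms]) (auto intro!: derivative_eq_intros)
  then show ?thesis
    by (auto simp: dt_def fun_eq_iff vector_derivative_at)
qed

lemma dx_eq_D:
  fixes g :: "(real ^ 'n::finite) \<times> real \<Rightarrow> complex"
  assumes "C_class (Suc k) g"
  shows "dx i g = D (axis i 1, 0) g"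
proof -
  have "((\<lambda>s. g (x + s *\<^sub>R axis i 1, t)) has_vector_derivative D (axis i 1, 0) g (x + 0 *\<^sub>R axis i 1, t)) (at 0)" for x t
    by (rule C_class_has_vector_derivative[OF assms]) (auto intro!: derivative_eq_intros)
  then show ?thesis
    by (auto simp: dx_def fun_eq_iff vector_derivative_at)
qed

lemma sum_Basis_vec: "(\<Sum>e\<in>(Basis :: (real ^ 'n::finite) set). F e) = (\<Sum>i\<in>UNIV. F (axis i 1))"
proof -
  have "(Basis :: (real ^ 'n) set) = range (\<lambda>i. axis i 1)"
    by (auto simp: Basis_vec_def)
  moreover have "sum F (range (\<lambda>i. axis i 1)) = (\<Sum>i\<in>UNIV. F (axis i 1))"
    by (subst sum.reindex) (auto simp: inj_on_def axis_eq_axis)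
  ultimately show ?thesis by simp
qed

lemma
  fixes g :: "(real ^ 'n::finite) \<times> real \<Rightarrow> complex"
  assumes "C_class 2 g"
  shows dt_dt_eq_D: "dt (dt g) = D (0, 1) (D (0, 1) g)"
    and laplacian_eq_D: "laplacian g p = (\<Sum>e\<in>Basis. D (e, 0) (D (e, 0) g) p)"
proof -
  have g: "C_class (Suc (Suc 0)) g" using assms by (simp add: numeral_2_eq_2)
  note g' = dt_eq_D[OF g] dx_eq_D[OF g] dt_eq_D[OF C_class_D[OF g]] dx_eq_D[OF C_class_D[OF g]]
  show "dt (dt g) = D (0, 1) (D (0, 1) g)" by (simp only: g')
  show "laplacian g p = (\<Sum>e\<in>Basis. D (e, 0) (D (e, 0) g) p)"
    unfolding laplacian_def sum_Basis_vec g' ..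
qed

lemma smooth_wave_family:
  fixes f :: "(real ^ 'n::finite) \<times> real \<Rightarrow> complex"
  assumes f: "C_infinity f"
    and w: "\<And>b. cauchy_solution 0 (\<lambda>_. 0) 0 (\<lambda>x. f (x, b)) (\<lambda>_. 0) (w b)"
  obtains W where "C_infinity W" "\<And>q. D (0, 1) (D (0, 1) W) q = lap (\<lambda>e. ((e, 0), 0)) W q"
    "\<And>p. W (p, 0) = f p" "\<And>p. D (0, 1) W (p, 0) = 0" "\<And>b x t. w b (x, t) = W ((x, b), t)"
proof -
  have "bounded_linear (\<lambda>x::real ^ 'n. (x, 0::real))"
    by (intro bounded_linear_intros)
  from smooth_wave_solution_exists[OF this f] obtain W :: "((real ^ 'n) \<times> real) \<times> real \<Rightarrow> complex" where
    W: "C_infinity W" "\<And>q. D (0, 1) (D (0, 1) W) q = lap (\<lambda>e. ((e, 0), 0)) W q"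
      "\<And>p. W (p, 0) = f p" "\<And>p. D (0, 1) W (p, 0) = 0" by blast
  have "w b (x, t) = W ((x, b), t)" for b x t
  proof -
    have wb: "C_class 2 (w b)" "\<And>p. dt (dt (w b)) p = laplacian (w b) p"
      "\<And>x. w b (x, 0) = f (x, b)" "\<And>x. dt (w b) (x, 0) = 0"
      using w[of b] by (auto simp: cauchy_solution_def)
    have wb2: "C_class (Suc (Suc 0)) (w b)" using wb(1) by (simp add: numeral_2_eq_2)
    define W' where "W' = (\<lambda>q::(real ^ 'n) \<times> real. W ((fst q, b), snd q))"
    have W': "C_infinity W'"
      unfolding W'_def by (intro C_infinity_compose[OF W(1)] C_infinity_intros)
    have D: "D d (\<lambda>q. g ((fst q, b), snd q)) = (\<lambda>q. D ((fst d, 0), snd d) g ((fst q, b), snd q))"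
      if "C_infinity g" for d and g :: "((real ^ 'n) \<times> real) \<times> real \<Rightarrow> complex"
      by (rule D_C_infinity_compose_affine[OF that]) (auto intro!: derivative_eq_intros)
    note DW' = D[OF W(1), folded W'_def] D[OF C_infinity_D[OF W(1)]]
    define z where "z = (\<lambda>q. w b q - W' q)"
    have Dz: "D d z = (\<lambda>q. D d (w b) q - D d W' q)" for d
      unfolding z_def
      by (intro ext D_eqI has_derivative_diff C_class_has_derivative[OF wb2] C_infinity_has_derivative[OF W'])
    have DDz: "D d' (D d z) = (\<lambda>q. D d' (D d (w b)) q - D d' (D d W') q)" for d d'
      unfolding Dz
      by (intro ext D_eqI has_derivative_diff C_class_has_derivative[OF C_class_D[OF wb2]]
          C_infinity_has_derivative[OF C_infinity_D[OF W']])
    have "z (x, t) = 0"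
    proof (rule wave_unique)
      show "C_class 2 z"
        using C_class_add[OF wb(1) C_infinity_imp_C_class[OF C_infinity_scaleR_const[OF W', of "-1"]]]
        by (simp add: z_def)
      show "D (0, 1) (D (0, 1) z) p = (\<Sum>e\<in>Basis. D (e, 0) (D (e, 0) z) p)" for p
        using wb(2)[of p] W(2)[of "((fst p, b), snd p)"]
        unfolding dt_dt_eq_D[OF wb(1)] laplacian_eq_D[OF wb(1)] lap_def
        by (simp add: DDz DW' sum_subtractf flip: zero_prod_def)
      show "z (x, 0) = 0" for x
        by (simp add: z_def W'_def wb W)
      show "D (0, 1) z (x, 0) = 0" for x
        using wb(4)[of x] W(4)[of "(x, b)"]
        unfolding dt_eq_D[OF wb2] by (simp add: Dz DW' flip: zero_prod_def)
    qed
    then show ?thesis by (simp add: z_def W'_def)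
  qed
  with W show ?thesis using that by blast
qed

lemma retarded_integral_eq_oint:
  fixes W :: "('a::euclidean_space \<times> real) \<times> real \<Rightarrow> complex"
  assumes W: "C_infinity W" and w: "\<And>b x t. w b (x, t) = W ((x, b), t)"
    and K: "\<And>y. y \<ge> 0 \<Longrightarrow> K (m * sqrt y) = bker c 0 y"
  shows "(LBINT b=ereal t0..ereal t. (LBINT r=0..ereal (t - b). K (m * sqrt ((t - b)\<^sup>2 - r\<^sup>2)) *\<^sub>R w b (x, r)))
    = oint (\<lambda>\<beta>. kgint c W ((x, t0 + \<beta>), t - (t0 + \<beta>))) (t - t0)"
proof -
  have inner: "(LBINT r=0..ereal \<tau>. K (m * sqrt (\<tau>\<^sup>2 - r\<^sup>2)) *\<^sub>R w b (x, r)) = kgint c W ((x, b), \<tau>)" for b \<tau>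
  proof -
    have "(LBINT r=ereal 0..ereal \<tau>. K (m * sqrt (\<tau>\<^sup>2 - r\<^sup>2)) *\<^sub>R w b (x, r))
        = (LBINT r=ereal 0..ereal \<tau>. bker c 0 (\<tau>\<^sup>2 - r\<^sup>2) *\<^sub>R W ((x, b), r))"
    proof (rule interval_integral_cong)
      fix r assume "r \<in> einterval (min (ereal 0) (ereal \<tau>)) (max (ereal 0) (ereal \<tau>))"
      then have "\<bar>r\<bar> \<le> \<bar>\<tau>\<bar>"
        by (auto simp: einterval_def min_def max_def split: if_splits)
      then have "\<tau>\<^sup>2 - r\<^sup>2 \<ge> 0"
        by (simp add: abs_le_square_iff)
      then show "K (m * sqrt (\<tau>\<^sup>2 - r\<^sup>2)) *\<^sub>R w b (x, r) = bker c 0 (\<tau>\<^sup>2 - r\<^sup>2) *\<^sub>R W ((x, b), r)"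
        by (simp only: K w)
    qed
    also have "\<dots> = oint (\<lambda>r. bker c 0 (\<tau>\<^sup>2 - r\<^sup>2) *\<^sub>R W ((x, b), r)) \<tau>"
      by (subst interval_integral_eq_oint)
        (simp_all add: C_infinity_scaleR C_infinity_bker_sq C_infinity_compose[OF W] C_infinity_intros)
    finally show ?thesis
      by (simp add: kgint_eq zero_ereal_def)
  qed
  show ?thesis
    unfolding inner
    by (rule interval_integral_eq_oint) (intro C_infinity_compose[OF C_infinity_kgint[OF W]] C_infinity_intros)
qed

theorem theorem1p1:
  fixes f :: "(real ^ 'n::finite) \<times> real \<Rightarrow> complex"
    and w :: "real \<Rightarrow> (real ^ 'n) \<times> real \<Rightarrow> complex"
    and u :: "(real ^ 'n) \<times> real \<Rightarrow> complex"
    and M :: complex and m t0 :: real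
  assumes "C_infinity f"
    and "M\<^sup>2 \<in> \<real>" and "M\<^sup>2 \<noteq> 0" and "m = cmod M"
    and "\<And>b. cauchy_solution 0 (\<lambda>_. 0) 0 (\<lambda>x. f (x, b)) (\<lambda>_. 0) (w b)"
    and "Re (M\<^sup>2) > 0 \<Longrightarrow> u = u_Re m t0 w"
    and "Re (M\<^sup>2) < 0 \<Longrightarrow> u = u_Im m t0 w"
  shows "cauchy_solution (M\<^sup>2) f t0 (\<lambda>_. 0) (\<lambda>_. 0) u"
proof -
  obtain W where W: "C_infinity W" "\<And>q. D (0, 1) (D (0, 1) W) q = lap (\<lambda>e. ((e, 0), 0)) W q"
    "\<And>p. W (p, 0) = f p" "\<And>p. D (0, 1) W (p, 0) = 0" "\<And>b x t. w b (x, t) = W ((x, b), t)"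
    using smooth_wave_family[OF assms(1,5)] by blast
  define c where "c = - Re (M\<^sup>2) / 4"
  have M2: "M\<^sup>2 = complex_of_real (- (4 * c))"
    using assms(2) by (simp add: c_def)
  have m2: "m\<^sup>2 = \<bar>Re (M\<^sup>2)\<bar>"
    using assms(2,4) by (metis Reals_cases Re_complex_of_real norm_of_real norm_power)
  have u: "u = (\<lambda>(x, t). oint (\<lambda>\<beta>. kgint c W ((x, t0 + \<beta>), t - (t0 + \<beta>))) (t - t0))"
  proof (cases "Re (M\<^sup>2) > 0")
    case True
    then have "- (m\<^sup>2 / 4) = c" by (simp add: m2 c_def)
    then show ?thesis
      unfolding assms(6)[OF True] u_Re_def
      by (subst retarded_integral_eq_oint[OF W(1,5), where c = c]) (use bessel_J0_eq_bker in auto)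
  next
    case False
    moreover have "Re (M\<^sup>2) \<noteq> 0"
      using assms(2,3) by (metis Reals_cases Re_complex_of_real of_real_0)
    ultimately have neg: "Re (M\<^sup>2) < 0" by simp
    then have "m\<^sup>2 / 4 = c" by (simp add: m2 c_def)
    then show ?thesis
      unfolding assms(7)[OF neg] u_Im_def
      by (subst retarded_integral_eq_oint[OF W(1,5), where c = c]) (use bessel_I0_eq_bker in auto)
  qed
  have kg: "C_infinity (kgint c W)" "\<And>p. kgint c W (p, 0) = 0" "\<And>p. D (0, 1) (kgint c W) (p, 0) = f p"
    "\<And>q. D (0, 1) (D (0, 1) (kgint c W)) q = lap (\<lambda>e. ((e, 0), 0)) (kgint c W) q + (4 * c) *\<^sub>R kgint c W q"
    using C_infinity_kgint[OF W(1)] kgint_initial[OF W(1)] W(3) klein_gordon_kgint[OF W(1,2,4)] by auto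
  have uC: "C_infinity u"
    unfolding u by (rule C_infinity_duhamel[OF kg])
  have u2: "C_class 2 u" "C_class (Suc 0) u"
    using uC by (rule C_infinity_imp_C_class)+
  show ?thesis
    unfolding cauchy_solution_def
  proof (intro conjI allI)
    show "C_class 2 u" by (rule u2)
    show "dt (dt u) p - laplacian u p + M\<^sup>2 * u p = f p" for p
      unfolding dt_dt_eq_D[OF u2(1)] laplacian_eq_D[OF u2(1)] M2
      using duhamel[OF kg, where s = t0 and p = p, folded u]
      by (simp add: lap_def scaleR_conv_of_real)
    show "u (x, t0) = 0" for x
      unfolding u by (rule duhamel_initial(1)[OF kg])
    show "dt u (x, t0) = 0" for x
      using duhamel_initial(2)[OF kg, where s = t0 and x = x, folded u] by (simp only: dt_eq_D[OF u2(2)])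
  qed
qed

end
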